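(* Let $I=\mathbb{2}$, and let $\mathcal{A}$ be the $2$-category generated by objects $X,A,B$; morphisms $\alpha_0,\alpha_1\colon X\to A$ and $f\colon A\to B$; and a $2$-morphism $\alpha\colon\alpha_0\Rightarrow\alpha_1$; subject to the relations $f\alpha_0=f\alpha_1$ and $f*\alpha=\mathrm{id}_{f\alpha_0}$. Consider the $2$-functor $f\colon\mathbb{2}\to\mathcal{A}$ given by the morphism $f\colon A\to B$, and let $\mathrm{id}_f\colon\Delta A\Rightarrow f$ be the lax-cone with components $\mathrm{id}_A\colon A\to A$ and $f\colon A\to B$ and with $2$-morphism component $\mathrm{id}_f$. Then $(A,\mathrm{id}_f)$ is the lax-limit of $f$ in $\mathcal{A}$, but it is not $2$-terminal in the lax-slice of lax-cones over $f$.
   Context: $\mathbb{2}$ is the category $\{0\to1\}$, regarded as a $2$-category with only identity $2$-morphisms. $2$-categories and $2$-functors are strict; $*$ denotes horizontal composition (and whiskering) of $2$-morphisms and juxtaposition denotes vertical composition. "Generated by the data subject to relations" means the $2$-category freely generated by the listed objects, morphisms and $2$-morphisms, modulo the listed relations. A lax-natural transformation $\mu\colon F\Rightarrow G$ between $2$-functors $F,G\colon I\to\mathcal{A}$ consists of morphisms $\mu_i\colon Fi\to Gi$ for $i\in I$ and $2$-morphisms $\mu_f\colon(Gf)\mu_i\Rightarrow\mu_j(Ff)$ for $f\colon i\to j$ in $I$, such that $\mu_{\mathrm{id}_i}=\mathrm{id}_{\mu_i}$, $\mu_{gf}=(\mu_g*Ff)(Gg*\mu_f)$ for composable $f,g$,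 and $\mu_g(G\alpha*\mu_i)=(\mu_j*F\alpha)\mu_f$ for every $2$-morphism $\alpha\colon f\Rightarrow g$ in $I$. A modification $\varphi\colon\mu\to\nu$ consists of $2$-morphisms $\varphi_i\colon\mu_i\Rightarrow\nu_i$ with $\nu_f(Gf*\varphi_i)=(\varphi_j*Ff)\mu_f$ for every $f\colon i\to j$. $\mathrm{Lax}[I,\mathcal{A}]$ is the $2$-category of $2$-functors, lax-natural transformations and modifications. $\Delta X$ is the constant $2$-functor at $X$; a lax-cone over a $2$-functor $F$ is a lax-natural transformation $\Delta X\Rightarrow F$. A lax-limit of $F$ is a pair $(L,\lambda\colon\Delta L\Rightarrow F)$ with $\lambda$ a lax-cone such that for each $X\in\mathcal{A}$ the functor $\lambda_*\circ\Delta\colon\mathcal{A}(X,L)\to\mathrm{Lax}[I,\mathcal{A}](\Delta X,F)$, given by post-composition with $\lambda$, is an isomorphism of categories. The lax-slice of lax-cones over $F$ is the $2$-category whose objects are pairs $(X,\mu)$ with $\mu\colon\Delta X\Rightarrow F$ a lax-cone; morphisms $(X,\mu)\to(Y,\nu)$ are pairs $(h,\varphi)$ of a morphism $h\colon X\to Y$ in $\mathcal{A}$ and a modification $\varphi\colon\nu\Delta h\to\mu$; $2$-morphisms $(h,\varphi)\Rightarrow(k,\psi)$ are $2$-morphisms $\beta\colon h\Rightarrow k$ in $\mathcal{A}$ with $\psi(\nu*\Delta\beta)=\varphi$. An object $L$ of a $2$-category $\mathcal{B}$ is $2$-terminal if for all $X\in\mathcal{B}$ the category $\mathcal{B}(X,L)$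 is isomorphic to the terminal category $\mathbb{1}$. *)

theory Defs
  imports Main "HOL-Library.FuncSet"
begin

section \<open>Categories and their isomorphisms\<close>

text \<open>Composition is written in applicative order throughout: \<open>g \<cdot> f\<close> is \<open>g\<close> after \<open>f\<close>.\<close>

record ('o, 'a) cat =
  Ob :: "'o set"
  Arr :: "'a set"
  cdom :: "'a \<Rightarrow> 'o"
  ccod :: "'a \<Rightarrow> 'o"
  cide :: "'o \<Rightarrow> 'a"
  ccomp :: "'a \<Rightarrow> 'a \<Rightarrow> 'a"

locale category =
  fixes C :: "('o, 'a) cat"
  assumes dom_cod: "f \<in> Arr C \<Longrightarrow> cdom C f \<in> Ob C \<and> ccod C f \<in> Ob C"
    and cide: "a \<in> Ob C \<Longrightarrow> cide C a \<in> Arr C \<and> cdom C (cide C a) = a \<and> ccod C (cide C a) = a"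
    and ccomp: "f \<in> Arr C \<Longrightarrow> g \<in> Arr C \<Longrightarrow> ccod C f = cdom C g \<Longrightarrow>
      ccomp C g f \<in> Arr C \<and> cdom C (ccomp C g f) = cdom C f \<and> ccod C (ccomp C g f) = ccod C g"
    and assoc: "f \<in> Arr C \<Longrightarrow> g \<in> Arr C \<Longrightarrow> h \<in> Arr C \<Longrightarrow> ccod C f = cdom C g \<Longrightarrow>
      ccod C g = cdom C h \<Longrightarrow> ccomp C h (ccomp C g f) = ccomp C (ccomp C h g) f"
    and ide_left: "f \<in> Arr C \<Longrightarrow> ccomp C (cide C (ccod C f)) f = f"
    and ide_right: "f \<in> Arr C \<Longrightarrow> ccomp C f (cide C (cdom C f)) = f"

locale cat_functor = C: category C + D: category D
  for C :: "('o, 'a) cat" and D :: "('p, 'b) cat" +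
  fixes FO :: "'o \<Rightarrow> 'p" and FA :: "'a \<Rightarrow> 'b"
  assumes FO: "a \<in> Ob C \<Longrightarrow> FO a \<in> Ob D"
    and FA: "f \<in> Arr C \<Longrightarrow> FA f \<in> Arr D \<and> cdom D (FA f) = FO (cdom C f) \<and> ccod D (FA f) = FO (ccod C f)"
    and FA_ide: "a \<in> Ob C \<Longrightarrow> FA (cide C a) = cide D (FO a)"
    and FA_comp: "f \<in> Arr C \<Longrightarrow> g \<in> Arr C \<Longrightarrow> ccod C f = cdom C g \<Longrightarrow>
      FA (ccomp C g f) = ccomp D (FA g) (FA f)"

definition cat_isomorphism ::
  "('o, 'a) cat \<Rightarrow> ('p, 'b) cat \<Rightarrow> ('o \<Rightarrow> 'p) \<Rightarrow> ('a \<Rightarrow> 'b) \<Rightarrow> bool" where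
  "cat_isomorphism C D FO FA \<longleftrightarrow> cat_functor C D FO FA \<and>
    (\<exists>GO GA. cat_functor D C GO GA \<and>
      (\<forall>a\<in>Ob C. GO (FO a) = a) \<and> (\<forall>f\<in>Arr C. GA (FA f) = f) \<and>
      (\<forall>b\<in>Ob D. FO (GO b) = b) \<and> (\<forall>g\<in>Arr D. FA (GA g) = g))"

definition cat_isomorphic :: "('o, 'a) cat \<Rightarrow> ('p, 'b) cat \<Rightarrow> bool" where
  "cat_isomorphic C D \<longleftrightarrow> (\<exists>FO FA. cat_isomorphism C D FO FA)"

definition terminal_cat :: "(unit, unit) cat" where
  "terminal_cat = \<lparr>Ob = UNIV, Arr = UNIV, cdom = (\<lambda>_. ()), ccod = (\<lambda>_. ()),
     cide = (\<lambda>_. ()), ccomp = (\<lambda>_ _. ())\<rparr>"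


section \<open>Strict 2-categories\<close>

record ('o, 'm, 'c) cat2 =
  Obj :: "'o set"
  Mor :: "'m set"
  Dom :: "'m \<Rightarrow> 'o"
  Cod :: "'m \<Rightarrow> 'o"
  Idm :: "'o \<Rightarrow> 'm"
  cmp :: "'m \<Rightarrow> 'm \<Rightarrow> 'm" (infixr "\<cdot>\<index>" 75)
  Cell :: "'c set"
  Src :: "'c \<Rightarrow> 'm"
  Tgt :: "'c \<Rightarrow> 'm"
  Idc :: "'m \<Rightarrow> 'c"
  vcmp :: "'c \<Rightarrow> 'c \<Rightarrow> 'c" (infixr "\<odot>\<index>" 65)
  hcmp :: "'c \<Rightarrow> 'c \<Rightarrow> 'c" (infixr "\<star>\<index>" 70)

text \<open>The whiskerings \<open>g * \<alpha>\<close> and \<open>\<alpha> * f\<close> are \<open>Idc g \<star> \<alpha>\<close> and \<open>\<alpha> \<star> Idc f\<close>.\<close>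

locale two_category =
  fixes A :: "('o, 'm, 'c) cat2" (structure)
  assumes Dom_Cod: "f \<in> Mor A \<Longrightarrow> Dom A f \<in> Obj A \<and> Cod A f \<in> Obj A"
    and Idm: "a \<in> Obj A \<Longrightarrow> Idm A a \<in> Mor A \<and> Dom A (Idm A a) = a \<and> Cod A (Idm A a) = a"
    and cmp: "f \<in> Mor A \<Longrightarrow> g \<in> Mor A \<Longrightarrow> Cod A f = Dom A g \<Longrightarrow>
      g \<cdot> f \<in> Mor A \<and> Dom A (g \<cdot> f) = Dom A f \<and> Cod A (g \<cdot> f) = Cod A g"
    and cmp_assoc: "f \<in> Mor A \<Longrightarrow> g \<in> Mor A \<Longrightarrow> h \<in> Mor A \<Longrightarrow> Cod A f = Dom A g \<Longrightarrow>
      Cod A g = Dom A h \<Longrightarrow> (h \<cdot> g) \<cdot> f = h \<cdot> (g \<cdot> f)"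
    and cmp_Idm_left: "f \<in> Mor A \<Longrightarrow> Idm A (Cod A f) \<cdot> f = f"
    and cmp_Idm_right: "f \<in> Mor A \<Longrightarrow> f \<cdot> Idm A (Dom A f) = f"
    and Src_Tgt: "\<alpha> \<in> Cell A \<Longrightarrow> Src A \<alpha> \<in> Mor A \<and> Tgt A \<alpha> \<in> Mor A \<and>
      Dom A (Src A \<alpha>) = Dom A (Tgt A \<alpha>) \<and> Cod A (Src A \<alpha>) = Cod A (Tgt A \<alpha>)"
    and Idc: "f \<in> Mor A \<Longrightarrow> Idc A f \<in> Cell A \<and> Src A (Idc A f) = f \<and> Tgt A (Idc A f) = f"
    and vcmp: "\<alpha> \<in> Cell A \<Longrightarrow> \<beta> \<in> Cell A \<Longrightarrow> Tgt A \<alpha> = Src A \<beta> \<Longrightarrow>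
      \<beta> \<odot> \<alpha> \<in> Cell A \<and> Src A (\<beta> \<odot> \<alpha>) = Src A \<alpha> \<and> Tgt A (\<beta> \<odot> \<alpha>) = Tgt A \<beta>"
    and vcmp_assoc: "\<alpha> \<in> Cell A \<Longrightarrow> \<beta> \<in> Cell A \<Longrightarrow> \<gamma> \<in> Cell A \<Longrightarrow> Tgt A \<alpha> = Src A \<beta> \<Longrightarrow>
      Tgt A \<beta> = Src A \<gamma> \<Longrightarrow> (\<gamma> \<odot> \<beta>) \<odot> \<alpha> = \<gamma> \<odot> (\<beta> \<odot> \<alpha>)"
    and vcmp_Idc_left: "\<alpha> \<in> Cell A \<Longrightarrow> Idc A (Tgt A \<alpha>) \<odot> \<alpha> = \<alpha>"
    and vcmp_Idc_right: "\<alpha> \<in> Cell A \<Longrightarrow> \<alpha> \<odot> Idc A (Src A \<alpha>) = \<alpha>"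
    and hcmp: "\<alpha> \<in> Cell A \<Longrightarrow> \<beta> \<in> Cell A \<Longrightarrow> Cod A (Src A \<alpha>) = Dom A (Src A \<beta>) \<Longrightarrow>
      \<beta> \<star> \<alpha> \<in> Cell A \<and> Src A (\<beta> \<star> \<alpha>) = Src A \<beta> \<cdot> Src A \<alpha> \<and> Tgt A (\<beta> \<star> \<alpha>) = Tgt A \<beta> \<cdot> Tgt A \<alpha>"
    and hcmp_assoc: "\<alpha> \<in> Cell A \<Longrightarrow> \<beta> \<in> Cell A \<Longrightarrow> \<gamma> \<in> Cell A \<Longrightarrow>
      Cod A (Src A \<alpha>) = Dom A (Src A \<beta>) \<Longrightarrow> Cod A (Src A \<beta>) = Dom A (Src A \<gamma>) \<Longrightarrow>
      (\<gamma> \<star> \<beta>) \<star> \<alpha> = \<gamma> \<star> (\<beta> \<star> \<alpha>)"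
    and hcmp_Idm_left: "\<alpha> \<in> Cell A \<Longrightarrow> Idc A (Idm A (Cod A (Src A \<alpha>))) \<star> \<alpha> = \<alpha>"
    and hcmp_Idm_right: "\<alpha> \<in> Cell A \<Longrightarrow> \<alpha> \<star> Idc A (Idm A (Dom A (Src A \<alpha>))) = \<alpha>"
    and hcmp_Idc: "f \<in> Mor A \<Longrightarrow> g \<in> Mor A \<Longrightarrow> Cod A f = Dom A g \<Longrightarrow>
      Idc A g \<star> Idc A f = Idc A (g \<cdot> f)"
    and interchange: "\<alpha> \<in> Cell A \<Longrightarrow> \<beta> \<in> Cell A \<Longrightarrow> \<alpha>' \<in> Cell A \<Longrightarrow> \<beta>' \<in> Cell A \<Longrightarrow>
      Tgt A \<alpha> = Src A \<beta> \<Longrightarrow> Tgt A \<alpha>' = Src A \<beta>' \<Longrightarrow> Cod A (Src A \<alpha>) = Dom A (Src A \<alpha>') \<Longrightarrow>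
      (\<beta>' \<odot> \<alpha>') \<star> (\<beta> \<odot> \<alpha>) = (\<beta>' \<star> \<beta>) \<odot> (\<alpha>' \<star> \<alpha>)"

definition hom_cat :: "('o, 'm, 'c) cat2 \<Rightarrow> 'o \<Rightarrow> 'o \<Rightarrow> ('m, 'c) cat" where
  "hom_cat A a b = \<lparr>
     Ob = {f \<in> Mor A. Dom A f = a \<and> Cod A f = b},
     Arr = {\<alpha> \<in> Cell A. Dom A (Src A \<alpha>) = a \<and> Cod A (Src A \<alpha>) = b},
     cdom = Src A, ccod = Tgt A, cide = Idc A, ccomp = vcmp A\<rparr>"

definition two_terminal :: "('o, 'm, 'c) cat2 \<Rightarrow> 'o \<Rightarrow> bool" where
  "two_terminal A L \<longleftrightarrow> L \<in> Obj A \<and> (\<forall>X\<in>Obj A. cat_isomorphic (hom_cat A X L) terminal_cat)"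

lemma (in two_category) category_hom_cat: "category (hom_cat A a b)"
  by unfold_locales
    (auto simp: hom_cat_def Src_Tgt Idc vcmp vcmp_assoc vcmp_Idc_left vcmp_Idc_right)


section \<open>2-functors, lax-natural transformations and modifications\<close>

text \<open>
  All the functions below are required to be \<open>extensional\<close> on the relevant part of the
  indexing 2-category, so that equality of records is equality of the mathematical objects.
\<close>

record ('i, 'j, 'k, 'o, 'm, 'c) fun2 =
  F0 :: "'i \<Rightarrow> 'o"
  F1 :: "'j \<Rightarrow> 'm"
  F2 :: "'k \<Rightarrow> 'c"

locale two_functor = I: two_category I + A: two_category A
  for I :: "('i, 'j, 'k) cat2" and A :: "('o, 'm, 'c) cat2" +
  fixes F :: "('i, 'j, 'k, 'o, 'm, 'c) fun2"
  assumes ext: "F0 F \<in> extensional (Obj I)" "F1 F \<in> extensional (Mor I)" "F2 F \<in> extensional (Cell I)"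
    and F0: "i \<in> Obj I \<Longrightarrow> F0 F i \<in> Obj A"
    and F1: "f \<in> Mor I \<Longrightarrow>
      F1 F f \<in> Mor A \<and> Dom A (F1 F f) = F0 F (Dom I f) \<and> Cod A (F1 F f) = F0 F (Cod I f)"
    and F2: "\<alpha> \<in> Cell I \<Longrightarrow>
      F2 F \<alpha> \<in> Cell A \<and> Src A (F2 F \<alpha>) = F1 F (Src I \<alpha>) \<and> Tgt A (F2 F \<alpha>) = F1 F (Tgt I \<alpha>)"
    and F1_Idm: "i \<in> Obj I \<Longrightarrow> F1 F (Idm I i) = Idm A (F0 F i)"
    and F1_cmp: "f \<in> Mor I \<Longrightarrow> g \<in> Mor I \<Longrightarrow> Cod I f = Dom I g \<Longrightarrow>
      F1 F (g \<cdot>\<^bsub>I\<^esub> f) = F1 F g \<cdot>\<^bsub>A\<^esub> F1 F f"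
    and F2_Idc: "f \<in> Mor I \<Longrightarrow> F2 F (Idc I f) = Idc A (F1 F f)"
    and F2_vcmp: "\<alpha> \<in> Cell I \<Longrightarrow> \<beta> \<in> Cell I \<Longrightarrow> Tgt I \<alpha> = Src I \<beta> \<Longrightarrow>
      F2 F (\<beta> \<odot>\<^bsub>I\<^esub> \<alpha>) = F2 F \<beta> \<odot>\<^bsub>A\<^esub> F2 F \<alpha>"
    and F2_hcmp: "\<alpha> \<in> Cell I \<Longrightarrow> \<beta> \<in> Cell I \<Longrightarrow> Cod I (Src I \<alpha>) = Dom I (Src I \<beta>) \<Longrightarrow>
      F2 F (\<beta> \<star>\<^bsub>I\<^esub> \<alpha>) = F2 F \<beta> \<star>\<^bsub>A\<^esub> F2 F \<alpha>"

record ('i, 'j, 'k, 'o, 'm, 'c) lax =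
  lsrc :: "('i, 'j, 'k, 'o, 'm, 'c) fun2"
  ltgt :: "('i, 'j, 'k, 'o, 'm, 'c) fun2"
  lmor :: "'i \<Rightarrow> 'm"
  lcell :: "'j \<Rightarrow> 'c"

locale lax_natural = F: two_functor I A "lsrc \<mu>" + G: two_functor I A "ltgt \<mu>"
  for I :: "('i, 'j, 'k) cat2" and A :: "('o, 'm, 'c) cat2"
    and \<mu> :: "('i, 'j, 'k, 'o, 'm, 'c) lax" +
  assumes ext: "lmor \<mu> \<in> extensional (Obj I)" "lcell \<mu> \<in> extensional (Mor I)"
    and lmor: "i \<in> Obj I \<Longrightarrow>
      lmor \<mu> i \<in> Mor A \<and> Dom A (lmor \<mu> i) = F0 (lsrc \<mu>) i \<and> Cod A (lmor \<mu> i) = F0 (ltgt \<mu>) i"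
    and lcell: "f \<in> Mor I \<Longrightarrow> lcell \<mu> f \<in> Cell A \<and>
      Src A (lcell \<mu> f) = F1 (ltgt \<mu>) f \<cdot>\<^bsub>A\<^esub> lmor \<mu> (Dom I f) \<and>
      Tgt A (lcell \<mu> f) = lmor \<mu> (Cod I f) \<cdot>\<^bsub>A\<^esub> F1 (lsrc \<mu>) f"
    and lcell_Idm: "i \<in> Obj I \<Longrightarrow> lcell \<mu> (Idm I i) = Idc A (lmor \<mu> i)"
    and lcell_cmp: "f \<in> Mor I \<Longrightarrow> g \<in> Mor I \<Longrightarrow> Cod I f = Dom I g \<Longrightarrow>
      lcell \<mu> (g \<cdot>\<^bsub>I\<^esub> f) =
        (lcell \<mu> g \<star>\<^bsub>A\<^esub> Idc A (F1 (lsrc \<mu>) f)) \<odot>\<^bsub>A\<^esub> (Idc A (F1 (ltgt \<mu>) g) \<star>\<^bsub>A\<^esub> lcell \<mu> f)"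
    and lcell_natural: "\<alpha> \<in> Cell I \<Longrightarrow>
      lcell \<mu> (Tgt I \<alpha>) \<odot>\<^bsub>A\<^esub> (F2 (ltgt \<mu>) \<alpha> \<star>\<^bsub>A\<^esub> Idc A (lmor \<mu> (Dom I (Src I \<alpha>)))) =
        (Idc A (lmor \<mu> (Cod I (Src I \<alpha>))) \<star>\<^bsub>A\<^esub> F2 (lsrc \<mu>) \<alpha>) \<odot>\<^bsub>A\<^esub> lcell \<mu> (Src I \<alpha>)"

record ('i, 'j, 'k, 'o, 'm, 'c) modif =
  msrc :: "('i, 'j, 'k, 'o, 'm, 'c) lax"
  mtgt :: "('i, 'j, 'k, 'o, 'm, 'c) lax"
  mcell :: "'i \<Rightarrow> 'c"

locale modification = \<mu>: lax_natural I A "msrc \<phi>" + \<nu>: lax_natural I A "mtgt \<phi>"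
  for I :: "('i, 'j, 'k) cat2" and A :: "('o, 'm, 'c) cat2"
    and \<phi> :: "('i, 'j, 'k, 'o, 'm, 'c) modif" +
  assumes parallel: "lsrc (msrc \<phi>) = lsrc (mtgt \<phi>)" "ltgt (msrc \<phi>) = ltgt (mtgt \<phi>)"
    and ext: "mcell \<phi> \<in> extensional (Obj I)"
    and mcell: "i \<in> Obj I \<Longrightarrow> mcell \<phi> i \<in> Cell A \<and>
      Src A (mcell \<phi> i) = lmor (msrc \<phi>) i \<and> Tgt A (mcell \<phi> i) = lmor (mtgt \<phi>) i"
    and mcell_natural: "f \<in> Mor I \<Longrightarrow>
      lcell (mtgt \<phi>) f \<odot>\<^bsub>A\<^esub> (Idc A (F1 (ltgt (msrc \<phi>)) f) \<star>\<^bsub>A\<^esub> mcell \<phi> (Dom I f)) =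
        (mcell \<phi> (Cod I f) \<star>\<^bsub>A\<^esub> Idc A (F1 (lsrc (msrc \<phi>)) f)) \<odot>\<^bsub>A\<^esub> lcell (msrc \<phi>) f"

definition lax_id ::
  "('i, 'j, 'k) cat2 \<Rightarrow> ('o, 'm, 'c) cat2 \<Rightarrow> ('i, 'j, 'k, 'o, 'm, 'c) fun2 \<Rightarrow>
   ('i, 'j, 'k, 'o, 'm, 'c) lax" where
  "lax_id I A F = \<lparr>lsrc = F, ltgt = F,
     lmor = (\<lambda>i\<in>Obj I. Idm A (F0 F i)),
     lcell = (\<lambda>f\<in>Mor I. Idc A (F1 F f))\<rparr>"

definition lax_cmp ::
  "('i, 'j, 'k) cat2 \<Rightarrow> ('o, 'm, 'c) cat2 \<Rightarrow> ('i, 'j, 'k, 'o, 'm, 'c) lax \<Rightarrow>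
   ('i, 'j, 'k, 'o, 'm, 'c) lax \<Rightarrow> ('i, 'j, 'k, 'o, 'm, 'c) lax" where
  "lax_cmp I A \<nu> \<mu> = \<lparr>lsrc = lsrc \<mu>, ltgt = ltgt \<nu>,
     lmor = (\<lambda>i\<in>Obj I. lmor \<nu> i \<cdot>\<^bsub>A\<^esub> lmor \<mu> i),
     lcell = (\<lambda>f\<in>Mor I. (Idc A (lmor \<nu> (Cod I f)) \<star>\<^bsub>A\<^esub> lcell \<mu> f) \<odot>\<^bsub>A\<^esub>
                         (lcell \<nu> f \<star>\<^bsub>A\<^esub> Idc A (lmor \<mu> (Dom I f))))\<rparr>"

definition Lax :: "('i, 'j, 'k) cat2 \<Rightarrow> ('o, 'm, 'c) cat2 \<Rightarrow>
    (('i, 'j, 'k, 'o, 'm, 'c) fun2, ('i, 'j, 'k, 'o, 'm, 'c) lax, ('i, 'j, 'k, 'o, 'm, 'c) modif) cat2"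
  where
  "Lax I A = \<lparr>
     Obj = {F. two_functor I A F},
     Mor = {\<mu>. lax_natural I A \<mu>},
     Dom = lsrc, Cod = ltgt, Idm = lax_id I A, cmp = lax_cmp I A,
     Cell = {\<phi>. modification I A \<phi>},
     Src = msrc, Tgt = mtgt,
     Idc = (\<lambda>\<mu>. \<lparr>msrc = \<mu>, mtgt = \<mu>, mcell = (\<lambda>i\<in>Obj I. Idc A (lmor \<mu> i))\<rparr>),
     vcmp = (\<lambda>\<psi> \<phi>. \<lparr>msrc = msrc \<phi>, mtgt = mtgt \<psi>,
       mcell = (\<lambda>i\<in>Obj I. mcell \<psi> i \<odot>\<^bsub>A\<^esub> mcell \<phi> i)\<rparr>),
     hcmp = (\<lambda>\<psi> \<phi>. \<lparr>msrc = lax_cmp I A (msrc \<psi>) (msrc \<phi>), mtgt = lax_cmp I A (mtgt \<psi>) (mtgt \<phi>),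
       mcell = (\<lambda>i\<in>Obj I. mcell \<psi> i \<star>\<^bsub>A\<^esub> mcell \<phi> i)\<rparr>)\<rparr>"


section \<open>Lax-cones, lax-limits and the lax-slice\<close>

text \<open>The 2-functor \<open>\<Delta>: A \<rightarrow> Lax[I, A]\<close> on objects, morphisms and 2-morphisms.\<close>

definition Delta0 ::
  "('i, 'j, 'k) cat2 \<Rightarrow> ('o, 'm, 'c) cat2 \<Rightarrow> 'o \<Rightarrow> ('i, 'j, 'k, 'o, 'm, 'c) fun2" where
  "Delta0 I A X = \<lparr>F0 = (\<lambda>i\<in>Obj I. X), F1 = (\<lambda>f\<in>Mor I. Idm A X),
     F2 = (\<lambda>\<alpha>\<in>Cell I. Idc A (Idm A X))\<rparr>"

definition Delta1 ::
  "('i, 'j, 'k) cat2 \<Rightarrow> ('o, 'm, 'c) cat2 \<Rightarrow> 'm \<Rightarrow> ('i, 'j, 'k, 'o, 'm, 'c) lax" where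
  "Delta1 I A h = \<lparr>lsrc = Delta0 I A (Dom A h), ltgt = Delta0 I A (Cod A h),
     lmor = (\<lambda>i\<in>Obj I. h), lcell = (\<lambda>f\<in>Mor I. Idc A h)\<rparr>"

definition Delta2 ::
  "('i, 'j, 'k) cat2 \<Rightarrow> ('o, 'm, 'c) cat2 \<Rightarrow> 'c \<Rightarrow> ('i, 'j, 'k, 'o, 'm, 'c) modif" where
  "Delta2 I A \<beta> = \<lparr>msrc = Delta1 I A (Src A \<beta>), mtgt = Delta1 I A (Tgt A \<beta>),
     mcell = (\<lambda>i\<in>Obj I. \<beta>)\<rparr>"

definition lax_cone ::
  "('i, 'j, 'k) cat2 \<Rightarrow> ('o, 'm, 'c) cat2 \<Rightarrow> ('i, 'j, 'k, 'o, 'm, 'c) fun2 \<Rightarrow> 'o \<Rightarrow>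
   ('i, 'j, 'k, 'o, 'm, 'c) lax \<Rightarrow> bool" where
  "lax_cone I A F X \<mu> \<longleftrightarrow>
     X \<in> Obj A \<and> lax_natural I A \<mu> \<and> lsrc \<mu> = Delta0 I A X \<and> ltgt \<mu> = F"

definition lax_limit ::
  "('i, 'j, 'k) cat2 \<Rightarrow> ('o, 'm, 'c) cat2 \<Rightarrow> ('i, 'j, 'k, 'o, 'm, 'c) fun2 \<Rightarrow>
   'o \<Rightarrow> ('i, 'j, 'k, 'o, 'm, 'c) lax \<Rightarrow> bool" where
  "lax_limit I A F L \<pi> \<longleftrightarrow> lax_cone I A F L \<pi> \<and>
     (\<forall>X\<in>Obj A. cat_isomorphism (hom_cat A X L) (hom_cat (Lax I A) (Delta0 I A X) F)
        (\<lambda>h. \<pi> \<cdot>\<^bsub>Lax I A\<^esub> Delta1 I A h)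
        (\<lambda>\<beta>. Idc (Lax I A) \<pi> \<star>\<^bsub>Lax I A\<^esub> Delta2 I A \<beta>))"

text \<open>
  A morphism \<open>(X, \<mu>) \<rightarrow> (Y, \<nu>)\<close> of the lax-slice carries its source and target in addition to
  the pair \<open>(h, \<phi>)\<close>; a 2-morphism carries its source and target in addition to \<open>\<beta>\<close>.
\<close>

record ('i, 'j, 'k, 'o, 'm, 'c) slice_mor =
  sdom :: "'o \<times> ('i, 'j, 'k, 'o, 'm, 'c) lax"
  scod :: "'o \<times> ('i, 'j, 'k, 'o, 'm, 'c) lax"
  smor :: 'm
  smod :: "('i, 'j, 'k, 'o, 'm, 'c) modif"

record ('i, 'j, 'k, 'o, 'm, 'c) slice_cell =
  ssrc :: "('i, 'j, 'k, 'o, 'm, 'c) slice_mor"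
  stgt :: "('i, 'j, 'k, 'o, 'm, 'c) slice_mor"
  scell :: 'c

definition is_slice_mor ::
  "('i, 'j, 'k) cat2 \<Rightarrow> ('o, 'm, 'c) cat2 \<Rightarrow> ('i, 'j, 'k, 'o, 'm, 'c) fun2 \<Rightarrow>
   ('i, 'j, 'k, 'o, 'm, 'c) slice_mor \<Rightarrow> bool" where
  "is_slice_mor I A F s \<longleftrightarrow>
     lax_cone I A F (fst (sdom s)) (snd (sdom s)) \<and>
     lax_cone I A F (fst (scod s)) (snd (scod s)) \<and>
     smor s \<in> Mor A \<and> Dom A (smor s) = fst (sdom s) \<and> Cod A (smor s) = fst (scod s) \<and>
     modification I A (smod s) \<and>
     msrc (smod s) = snd (scod s) \<cdot>\<^bsub>Lax I A\<^esub> Delta1 I A (smor s) \<and>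
     mtgt (smod s) = snd (sdom s)"

definition is_slice_cell ::
  "('i, 'j, 'k) cat2 \<Rightarrow> ('o, 'm, 'c) cat2 \<Rightarrow> ('i, 'j, 'k, 'o, 'm, 'c) fun2 \<Rightarrow>
   ('i, 'j, 'k, 'o, 'm, 'c) slice_cell \<Rightarrow> bool" where
  "is_slice_cell I A F b \<longleftrightarrow>
     is_slice_mor I A F (ssrc b) \<and> is_slice_mor I A F (stgt b) \<and>
     sdom (ssrc b) = sdom (stgt b) \<and> scod (ssrc b) = scod (stgt b) \<and>
     scell b \<in> Cell A \<and> Src A (scell b) = smor (ssrc b) \<and> Tgt A (scell b) = smor (stgt b) \<and>
     smod (stgt b) \<odot>\<^bsub>Lax I A\<^esub> (Idc (Lax I A) (snd (scod (ssrc b))) \<star>\<^bsub>Lax I A\<^esub> Delta2 I A (scell b))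
       = smod (ssrc b)"

definition slice_cmp ::
  "('i, 'j, 'k) cat2 \<Rightarrow> ('o, 'm, 'c) cat2 \<Rightarrow> ('i, 'j, 'k, 'o, 'm, 'c) slice_mor \<Rightarrow>
   ('i, 'j, 'k, 'o, 'm, 'c) slice_mor \<Rightarrow> ('i, 'j, 'k, 'o, 'm, 'c) slice_mor" where
  "slice_cmp I A t s = \<lparr>sdom = sdom s, scod = scod t, smor = smor t \<cdot>\<^bsub>A\<^esub> smor s,
     smod = smod s \<odot>\<^bsub>Lax I A\<^esub> (smod t \<star>\<^bsub>Lax I A\<^esub> Idc (Lax I A) (Delta1 I A (smor s)))\<rparr>"

definition lax_slice ::
  "('i, 'j, 'k) cat2 \<Rightarrow> ('o, 'm, 'c) cat2 \<Rightarrow> ('i, 'j, 'k, 'o, 'm, 'c) fun2 \<Rightarrow>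
   ('o \<times> ('i, 'j, 'k, 'o, 'm, 'c) lax, ('i, 'j, 'k, 'o, 'm, 'c) slice_mor,
    ('i, 'j, 'k, 'o, 'm, 'c) slice_cell) cat2" where
  "lax_slice I A F = \<lparr>
     Obj = {(X, \<mu>). lax_cone I A F X \<mu>},
     Mor = {s. is_slice_mor I A F s},
     Dom = sdom, Cod = scod,
     Idm = (\<lambda>(X, \<mu>). \<lparr>sdom = (X, \<mu>), scod = (X, \<mu>), smor = Idm A X, smod = Idc (Lax I A) \<mu>\<rparr>),
     cmp = slice_cmp I A,
     Cell = {b. is_slice_cell I A F b},
     Src = ssrc, Tgt = stgt,
     Idc = (\<lambda>s. \<lparr>ssrc = s, stgt = s, scell = Idc A (smor s)\<rparr>),
     vcmp = (\<lambda>c b. \<lparr>ssrc = ssrc b, stgt = stgt c, scell = scell c \<odot>\<^bsub>A\<^esub> scell b\<rparr>),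
     hcmp = (\<lambda>c b. \<lparr>ssrc = slice_cmp I A (ssrc c) (ssrc b), stgt = slice_cmp I A (stgt c) (stgt b),
       scell = scell c \<star>\<^bsub>A\<^esub> scell b\<rparr>)\<rparr>"


section \<open>The 2-category \<open>\<two>\<close> and diagrams of shape \<open>\<two>\<close>\<close>

definition locally_discrete :: "('o, 'a) cat \<Rightarrow> ('o, 'a, 'a) cat2" where
  "locally_discrete C = \<lparr>
     Obj = Ob C, Mor = Arr C, Dom = cdom C, Cod = ccod C, Idm = cide C, cmp = ccomp C,
     Cell = Arr C, Src = (\<lambda>f. f), Tgt = (\<lambda>f. f), Idc = (\<lambda>f. f), vcmp = (\<lambda>g f. g), hcmp = ccomp C\<rparr>"

text \<open>The category \<open>{0 \<rightarrow> 1}\<close>, with \<open>0 = False\<close> and \<open>1 = True\<close>.\<close>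

definition arrow_cat :: "(bool, bool \<times> bool) cat" where
  "arrow_cat = \<lparr>Ob = UNIV, Arr = {(i, j). i \<le> j}, cdom = fst, ccod = snd,
     cide = (\<lambda>i. (i, i)), ccomp = (\<lambda>g f. (fst f, snd g))\<rparr>"

definition Two :: "(bool, bool \<times> bool, bool \<times> bool) cat2" where
  "Two = locally_discrete arrow_cat"

lemma category_arrow_cat: "category arrow_cat"
  by unfold_locales (auto simp: arrow_cat_def)

lemma (in category) two_category_locally_discrete: "two_category (locally_discrete C)"
  by unfold_locales (auto simp: locally_discrete_def dom_cod cide ccomp assoc ide_left ide_right)

lemma two_category_Two: "two_category Two"
  unfolding Two_def
  by (rule category.two_category_locally_discrete[OF category_arrow_cat])

text \<open>The 2-functor \<open>\<two> \<rightarrow> A\<close> given by a morphism \<open>f\<close> of \<open>A\<close>.\<close>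

definition mor_functor ::
  "('o, 'm, 'c) cat2 \<Rightarrow> 'm \<Rightarrow> (bool, bool \<times> bool, bool \<times> bool, 'o, 'm, 'c) fun2" where
  "mor_functor A f =
     (let G0 = (\<lambda>i. if i then Cod A f else Dom A f);
          G1 = (\<lambda>(i, j). if i = j then Idm A (G0 i) else f)
      in \<lparr>F0 = (\<lambda>i\<in>Obj Two. G0 i), F1 = (\<lambda>u\<in>Mor Two. G1 u), F2 = (\<lambda>u\<in>Cell Two. Idc A (G1 u))\<rparr>)"

text \<open>
  The lax-cone \<open>id\<^sub>f\<close> over \<open>f\<close>. The 2-morphism component at \<open>0 \<rightarrow> 1\<close> is the identity on \<open>f\<close>;
  those at the identities of \<open>0\<close> and \<open>1\<close> have to be the identities on \<open>id\<close> and \<open>f\<close>. In each case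
  this is the identity on the component at the codomain.
\<close>

definition mor_cone ::
  "('o, 'm, 'c) cat2 \<Rightarrow> 'm \<Rightarrow> (bool, bool \<times> bool, bool \<times> bool, 'o, 'm, 'c) lax" where
  "mor_cone A f =
     (let k = (\<lambda>i. if i then f else Idm A (Dom A f))
      in \<lparr>lsrc = Delta0 Two A (Dom A f), ltgt = mor_functor A f,
          lmor = (\<lambda>i\<in>Obj Two. k i), lcell = (\<lambda>u\<in>Mor Two. Idc A (k (snd u)))\<rparr>)"


context two_category
begin

lemmas Idm' = Idm[THEN conjunct1] Idm[THEN conjunct2, THEN conjunct1] Idm[THEN conjunct2, THEN conjunct2]
lemmas Idc' = Idc[THEN conjunct1] Idc[THEN conjunct2, THEN conjunct1] Idc[THEN conjunct2, THEN conjunct2]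

lemma Idm_idem: "a \<in> Obj A \<Longrightarrow> Idm A a \<cdot> Idm A a = Idm A a"
  using cmp_Idm_left[of "Idm A a"] by (simp add: Idm')

lemma Idc_idem: "g \<in> Mor A \<Longrightarrow> Idc A g \<odot> Idc A g = Idc A g"
  using vcmp_Idc_left[of "Idc A g"] by (simp add: Idc')

lemma two_functor_Delta0:
  assumes "two_category I" "X \<in> Obj A"
  shows "two_functor I A (Delta0 I A X)"
proof -
  interpret I: two_category I by fact
  show ?thesis
    by unfold_locales
      (use assms(2) Idm[of X] Idc[of "Idm A X"] cmp_Idm_left[of "Idm A X"]
          vcmp_Idc_left[of "Idc A (Idm A X)"] hcmp_Idm_left[of "Idc A (Idm A X)"]
       in \<open>auto simp: Delta0_def I.Dom_Cod I.Idm I.cmp I.Src_Tgt I.Idc I.vcmp I.hcmp\<close>)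
qed

lemma two_functor_mor_functor:
  assumes f: "f \<in> Mor A"
  shows "two_functor Two A (mor_functor A f)"
proof -
  interpret T: two_category Two by (rule two_category_Two)
  have f': "Dom A f \<in> Obj A" "Cod A f \<in> Obj A" using Dom_Cod[OF f] by auto
  show ?thesis
    by unfold_locales
      (use f f' in \<open>auto simp: mor_functor_def Let_def Two_def locally_discrete_def arrow_cat_def
        Idm' Idc' Idm_idem Idc_idem cmp_Idm_left cmp_Idm_right hcmp_Idc split: if_splits\<close>)
qed

lemma lax_cone_mor_cone:
  assumes f: "f \<in> Mor A"
  shows "lax_cone Two A (mor_functor A f) (Dom A f) (mor_cone A f)"
proof -
  have f': "Dom A f \<in> Obj A" "Cod A f \<in> Obj A" using Dom_Cod[OF f] by auto
  interpret D: two_functor Two A "Delta0 Two A (Dom A f)"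
    by (rule two_functor_Delta0[OF two_category_Two f'(1)])
  interpret M: two_functor Two A "mor_functor A f"
    by (rule two_functor_mor_functor[OF f])
  have "lax_natural Two A (mor_cone A f)"
    by (intro lax_natural.intro lax_natural_axioms.intro)
      (use f f' D.two_functor_axioms M.two_functor_axioms in
        \<open>auto simp: mor_cone_def Delta0_def mor_functor_def Let_def Two_def locally_discrete_def
          arrow_cat_def Idm' Idc' Idm_idem Idc_idem cmp_Idm_left cmp_Idm_right hcmp_Idc split: if_splits\<close>)
  then show ?thesis
    using f' by (simp add: lax_cone_def mor_cone_def Let_def)
qed

end


section \<open>2-categories generated by data subject to relations\<close>

text \<open>
  Morphisms and 2-morphisms of the generated 2-category are well-formed formal composites of the
  generators, modulo the least congruence containing the axioms of a 2-category and the given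
  relations. Well-formedness of 2-morphism terms refers to the congruence on morphism terms,
  so relations between 2-morphisms may depend on relations between morphisms.
\<close>

datatype ('o, 'm) mterm = MId 'o | MGen 'm | MCmp "('o, 'm) mterm" "('o, 'm) mterm"

datatype ('o, 'm, 'c) cterm =
    CId "('o, 'm) mterm"
  | CGen 'c
  | CV "('o, 'm, 'c) cterm" "('o, 'm, 'c) cterm"
  | CH "('o, 'm, 'c) cterm" "('o, 'm, 'c) cterm"

record ('o, 'm, 'c) presentation =
  gen_obj :: "'o set"
  gen_mor :: "'m set"
  gdom :: "'m \<Rightarrow> 'o"
  gcod :: "'m \<Rightarrow> 'o"
  rel_mor :: "(('o, 'm) mterm \<times> ('o, 'm) mterm) set"
  gen_cell :: "'c set"
  gsrc :: "'c \<Rightarrow> ('o, 'm) mterm"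
  gtgt :: "'c \<Rightarrow> ('o, 'm) mterm"
  rel_cell :: "(('o, 'm, 'c) cterm \<times> ('o, 'm, 'c) cterm) set"

primrec mdom :: "('o, 'm, 'c) presentation \<Rightarrow> ('o, 'm) mterm \<Rightarrow> 'o" where
  "mdom P (MId a) = a"
| "mdom P (MGen m) = gdom P m"
| "mdom P (MCmp q p) = mdom P p"

primrec mcod :: "('o, 'm, 'c) presentation \<Rightarrow> ('o, 'm) mterm \<Rightarrow> 'o" where
  "mcod P (MId a) = a"
| "mcod P (MGen m) = gcod P m"
| "mcod P (MCmp q p) = mcod P q"

primrec mwf :: "('o, 'm, 'c) presentation \<Rightarrow> ('o, 'm) mterm \<Rightarrow> bool" where
  "mwf P (MId a) \<longleftrightarrow> a \<in> gen_obj P"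
| "mwf P (MGen m) \<longleftrightarrow> m \<in> gen_mor P"
| "mwf P (MCmp q p) \<longleftrightarrow> mwf P q \<and> mwf P p \<and> mcod P p = mdom P q"

inductive meq :: "('o, 'm, 'c) presentation \<Rightarrow> ('o, 'm) mterm \<Rightarrow> ('o, 'm) mterm \<Rightarrow> bool"
  for P where
  meq_rel: "(p, q) \<in> rel_mor P \<Longrightarrow> meq P p q"
| meq_refl: "mwf P p \<Longrightarrow> meq P p p"
| meq_sym: "meq P p q \<Longrightarrow> meq P q p"
| meq_trans: "meq P p q \<Longrightarrow> meq P q r \<Longrightarrow> meq P p r"
| meq_cmp: "meq P p p' \<Longrightarrow> meq P q q' \<Longrightarrow> mcod P p = mdom P q \<Longrightarrow> meq P (MCmp q p) (MCmp q' p')"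
| meq_assoc: "mwf P (MCmp r (MCmp q p)) \<Longrightarrow> meq P (MCmp (MCmp r q) p) (MCmp r (MCmp q p))"
| meq_id_left: "mwf P p \<Longrightarrow> meq P (MCmp (MId (mcod P p)) p) p"
| meq_id_right: "mwf P p \<Longrightarrow> meq P (MCmp p (MId (mdom P p))) p"

primrec csrc :: "('o, 'm, 'c) presentation \<Rightarrow> ('o, 'm, 'c) cterm \<Rightarrow> ('o, 'm) mterm" where
  "csrc P (CId p) = p"
| "csrc P (CGen c) = gsrc P c"
| "csrc P (CV y x) = csrc P x"
| "csrc P (CH y x) = MCmp (csrc P y) (csrc P x)"

primrec ctgt :: "('o, 'm, 'c) presentation \<Rightarrow> ('o, 'm, 'c) cterm \<Rightarrow> ('o, 'm) mterm" where
  "ctgt P (CId p) = p"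
| "ctgt P (CGen c) = gtgt P c"
| "ctgt P (CV y x) = ctgt P y"
| "ctgt P (CH y x) = MCmp (ctgt P y) (ctgt P x)"

primrec cwf :: "('o, 'm, 'c) presentation \<Rightarrow> ('o, 'm, 'c) cterm \<Rightarrow> bool" where
  "cwf P (CId p) \<longleftrightarrow> mwf P p"
| "cwf P (CGen c) \<longleftrightarrow> c \<in> gen_cell P"
| "cwf P (CV y x) \<longleftrightarrow> cwf P y \<and> cwf P x \<and> meq P (ctgt P x) (csrc P y)"
| "cwf P (CH y x) \<longleftrightarrow> cwf P y \<and> cwf P x \<and> mcod P (csrc P x) = mdom P (csrc P y)"

inductive ceq :: "('o, 'm, 'c) presentation \<Rightarrow> ('o, 'm, 'c) cterm \<Rightarrow> ('o, 'm, 'c) cterm \<Rightarrow> bool"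
  for P where
  ceq_rel: "(x, y) \<in> rel_cell P \<Longrightarrow> ceq P x y"
| ceq_refl: "cwf P x \<Longrightarrow> ceq P x x"
| ceq_sym: "ceq P x y \<Longrightarrow> ceq P y x"
| ceq_trans: "ceq P x y \<Longrightarrow> ceq P y z \<Longrightarrow> ceq P x z"
| ceq_id: "meq P p q \<Longrightarrow> ceq P (CId p) (CId q)"
| ceq_v: "ceq P x x' \<Longrightarrow> ceq P y y' \<Longrightarrow> cwf P (CV y x) \<Longrightarrow> ceq P (CV y x) (CV y' x')"
| ceq_h: "ceq P x x' \<Longrightarrow> ceq P y y' \<Longrightarrow> cwf P (CH y x) \<Longrightarrow> ceq P (CH y x) (CH y' x')"
| ceq_v_assoc: "cwf P (CV z (CV y x)) \<Longrightarrow> ceq P (CV (CV z y) x) (CV z (CV y x))"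
| ceq_v_id_left: "cwf P x \<Longrightarrow> ceq P (CV (CId (ctgt P x)) x) x"
| ceq_v_id_right: "cwf P x \<Longrightarrow> ceq P (CV x (CId (csrc P x))) x"
| ceq_h_assoc: "cwf P (CH z (CH y x)) \<Longrightarrow> ceq P (CH (CH z y) x) (CH z (CH y x))"
| ceq_h_id_left: "cwf P x \<Longrightarrow> ceq P (CH (CId (MId (mcod P (csrc P x)))) x) x"
| ceq_h_id_right: "cwf P x \<Longrightarrow> ceq P (CH x (CId (MId (mdom P (csrc P x))))) x"
| ceq_h_id: "mwf P (MCmp q p) \<Longrightarrow> ceq P (CH (CId q) (CId p)) (CId (MCmp q p))"
| ceq_interchange: "cwf P (CH (CV y' x') (CV y x)) \<Longrightarrow>
    ceq P (CH (CV y' x') (CV y x)) (CV (CH y' y) (CH x' x))"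

definition mclass :: "('o, 'm, 'c) presentation \<Rightarrow> ('o, 'm) mterm \<Rightarrow> ('o, 'm) mterm set" where
  "mclass P p = {q. meq P p q}"

definition cclass :: "('o, 'm, 'c) presentation \<Rightarrow> ('o, 'm, 'c) cterm \<Rightarrow> ('o, 'm, 'c) cterm set" where
  "cclass P x = {y. ceq P x y}"

definition rep :: "'a set \<Rightarrow> 'a" where
  "rep S = (SOME x. x \<in> S)"

definition generated_cat2 :: "('o, 'm, 'c) presentation \<Rightarrow>
    ('o, ('o, 'm) mterm set, ('o, 'm, 'c) cterm set) cat2" where
  "generated_cat2 P = \<lparr>
     Obj = gen_obj P,
     Mor = mclass P ` {p. mwf P p},
     Dom = (\<lambda>S. mdom P (rep S)),
     Cod = (\<lambda>S. mcod P (rep S)),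
     Idm = (\<lambda>a. mclass P (MId a)),
     cmp = (\<lambda>T S. mclass P (MCmp (rep T) (rep S))),
     Cell = cclass P ` {x. cwf P x},
     Src = (\<lambda>S. mclass P (csrc P (rep S))),
     Tgt = (\<lambda>S. mclass P (ctgt P (rep S))),
     Idc = (\<lambda>S. cclass P (CId (rep S))),
     vcmp = (\<lambda>T S. cclass P (CV (rep T) (rep S))),
     hcmp = (\<lambda>T S. cclass P (CH (rep T) (rep S)))\<rparr>"

locale presentation =
  fixes P :: "('o, 'm, 'c) presentation"
  assumes gen_mor: "m \<in> gen_mor P \<Longrightarrow> gdom P m \<in> gen_obj P \<and> gcod P m \<in> gen_obj P"
    and rel_mor: "(p, q) \<in> rel_mor P \<Longrightarrow>
      mwf P p \<and> mwf P q \<and> mdom P p = mdom P q \<and> mcod P p = mcod P q"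
    and gen_cell: "c \<in> gen_cell P \<Longrightarrow> mwf P (gsrc P c) \<and> mwf P (gtgt P c) \<and>
      mdom P (gsrc P c) = mdom P (gtgt P c) \<and> mcod P (gsrc P c) = mcod P (gtgt P c)"
    and rel_cell: "(x, y) \<in> rel_cell P \<Longrightarrow> cwf P x \<and> cwf P y \<and>
      meq P (csrc P x) (csrc P y) \<and> meq P (ctgt P x) (ctgt P y)"
begin

lemma mdom_mcod: "mwf P p \<Longrightarrow> mdom P p \<in> gen_obj P \<and> mcod P p \<in> gen_obj P"
  by (induction p) (auto simp: gen_mor)

lemma meq_wf: "meq P p q \<Longrightarrow> mwf P p \<and> mwf P q \<and> mdom P p = mdom P q \<and> mcod P p = mcod P q"
  by (induction rule: meq.induct) (auto simp: rel_mor mdom_mcod)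

lemma csrc_ctgt: "cwf P x \<Longrightarrow> mwf P (csrc P x) \<and> mwf P (ctgt P x) \<and>
    mdom P (csrc P x) = mdom P (ctgt P x) \<and> mcod P (csrc P x) = mcod P (ctgt P x)"
  by (induction x) (auto simp: gen_cell dest: meq_wf)

lemma ceq_wf: "ceq P x y \<Longrightarrow> cwf P x \<and> cwf P y \<and>
    meq P (csrc P x) (csrc P y) \<and> meq P (ctgt P x) (ctgt P y)"
proof (induction rule: ceq.induct)
  case (ceq_rel x y)
  then show ?case using rel_cell by blast
next
  case (ceq_v x x' y y')
  then show ?case by (auto intro: meq.intros)
next
  case (ceq_h x x' y y')
  then show ?case
    using csrc_ctgt[of x] csrc_ctgt[of y] meq_wf[of "csrc P x" "csrc P x'"] meq_wf[of "csrc P y" "csrc P y'"]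
    by (auto intro!: meq_cmp)
next
  case (ceq_interchange y' x' y x)
  then show ?case using csrc_ctgt[of x] csrc_ctgt[of y] csrc_ctgt[of x'] csrc_ctgt[of y']
      meq_wf[of "ctgt P x" "csrc P y"] meq_wf[of "ctgt P x'" "csrc P y'"]
    by (auto intro!: meq_cmp meq_refl)
next
  case (ceq_h_id_left x)
  then show ?case using csrc_ctgt[of x] meq_id_left[of P "csrc P x"] meq_id_left[of P "ctgt P x"]
    by (auto simp: mdom_mcod)
next
  case (ceq_h_id_right x)
  then show ?case using csrc_ctgt[of x] meq_id_right[of P "csrc P x"] meq_id_right[of P "ctgt P x"]
    by (auto simp: mdom_mcod)
qed (auto simp: csrc_ctgt mdom_mcod intro: meq.intros dest: meq_wf)

lemma mclass_eq: "mwf P p \<Longrightarrow> mclass P p = mclass P q \<longleftrightarrow> meq P p q"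
  unfolding mclass_def by (auto intro: meq.intros)

lemma cclass_eq: "cwf P x \<Longrightarrow> cclass P x = cclass P y \<longleftrightarrow> ceq P x y"
  unfolding cclass_def by (auto intro: ceq.intros)

lemma rep_mclass: "mwf P p \<Longrightarrow> meq P p (rep (mclass P p))"
  unfolding rep_def mclass_def by (rule someI2[of _ p]) (auto intro: meq_refl)

lemma rep_cclass: "cwf P x \<Longrightarrow> ceq P x (rep (cclass P x))"
  unfolding rep_def cclass_def by (rule someI2[of _ x]) (auto intro: ceq_refl)

lemma Dom_Cod_mclass:
  "mwf P p \<Longrightarrow> Dom (generated_cat2 P) (mclass P p) = mdom P p \<and>
     Cod (generated_cat2 P) (mclass P p) = mcod P p"
  using meq_wf[OF rep_mclass] by (simp add: generated_cat2_def)

lemma cmp_mclass: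
  "mwf P (MCmp q p) \<Longrightarrow> mclass P q \<cdot>\<^bsub>generated_cat2 P\<^esub> mclass P p = mclass P (MCmp q p)"
  unfolding generated_cat2_def
  by (simp, subst eq_commute, subst mclass_eq) (auto intro!: meq_cmp rep_mclass)

lemma Src_Tgt_cclass:
  "cwf P x \<Longrightarrow> Src (generated_cat2 P) (cclass P x) = mclass P (csrc P x) \<and>
     Tgt (generated_cat2 P) (cclass P x) = mclass P (ctgt P x)"
  using ceq_wf[OF rep_cclass[of x]] csrc_ctgt[of x] mclass_eq
  unfolding generated_cat2_def by (metis cat2.select_convs(8,9))

lemma Idc_mclass: "mwf P p \<Longrightarrow> Idc (generated_cat2 P) (mclass P p) = cclass P (CId p)"
  unfolding generated_cat2_def
  by (simp, subst eq_commute, subst cclass_eq) (auto intro!: ceq_id rep_mclass)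

lemma vcmp_cclass:
  "cwf P (CV y x) \<Longrightarrow> cclass P y \<odot>\<^bsub>generated_cat2 P\<^esub> cclass P x = cclass P (CV y x)"
  unfolding generated_cat2_def
  by (simp, subst eq_commute, subst cclass_eq) (auto intro!: ceq_v rep_cclass)

lemma hcmp_cclass:
  "cwf P (CH y x) \<Longrightarrow> cclass P y \<star>\<^bsub>generated_cat2 P\<^esub> cclass P x = cclass P (CH y x)"
  unfolding generated_cat2_def
  by (simp, subst eq_commute, subst cclass_eq) (auto intro!: ceq_h rep_cclass)

lemma two_category_generated: "two_category (generated_cat2 P)"
proof -
  have sets: "Obj (generated_cat2 P) = gen_obj P" "Mor (generated_cat2 P) = mclass P ` {p. mwf P p}"
    "Cell (generated_cat2 P) = cclass P ` {x. cwf P x}"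
    "\<And>a. Idm (generated_cat2 P) a = mclass P (MId a)"
    by (simp_all add: generated_cat2_def)
  have tgt: "mwf P (csrc P x)" "mwf P (ctgt P x)" "mdom P (ctgt P x) = mdom P (csrc P x)"
    "mcod P (ctgt P x) = mcod P (csrc P x)" if "cwf P x" for x
    using csrc_ctgt[OF that] by auto
  have mI: "p \<in> Collect (mwf P) \<Longrightarrow> mclass P p \<in> mclass P ` Collect (mwf P)" for p by blast
  have cI: "x \<in> Collect (cwf P) \<Longrightarrow> cclass P x \<in> cclass P ` Collect (cwf P)" for x by blast
  have endp: "mdom P (csrc P y) = mdom P (csrc P x)" "mcod P (csrc P y) = mcod P (csrc P x)"
    if "meq P (ctgt P x) (csrc P y)" "cwf P x" for x y
    using meq_wf[of "ctgt P x" "csrc P y"] tgt[of x] that by auto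
  note axs = meq_assoc meq_id_left meq_id_right ceq_v_assoc ceq_v_id_left ceq_v_id_right
    ceq_h_assoc ceq_h_id_left ceq_h_id_right ceq_h_id ceq_interchange meq_cmp
  note [simp] = sets Dom_Cod_mclass cmp_mclass Src_Tgt_cclass Idc_mclass vcmp_cclass hcmp_cclass
    mdom_mcod tgt meq_refl mclass_eq cclass_eq
  show ?thesis
    by unfold_locales
      (auto simp: axs endp intro!: mI cI del: equalityI image_eqI)
qed

end


section \<open>The 2-category of the example\<close>

datatype gen0 = gX | gA | gB
datatype gen1 = g\<alpha>0 | g\<alpha>1 | gf
datatype gen2 = g\<alpha>

definition example_presentation :: "(gen0, gen1, gen2) presentation" where
  "example_presentation = \<lparr>
     gen_obj = UNIV,
     gen_mor = UNIV,
     gdom = (\<lambda>m. case m of g\<alpha>0 \<Rightarrow> gX | g\<alpha>1 \<Rightarrow> gX | gf \<Rightarrow> gA),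
     gcod = (\<lambda>m. case m of g\<alpha>0 \<Rightarrow> gA | g\<alpha>1 \<Rightarrow> gA | gf \<Rightarrow> gB),
     rel_mor = {(MCmp (MGen gf) (MGen g\<alpha>0), MCmp (MGen gf) (MGen g\<alpha>1))},
     gen_cell = UNIV,
     gsrc = (\<lambda>_. MGen g\<alpha>0),
     gtgt = (\<lambda>_. MGen g\<alpha>1),
     rel_cell = {(CH (CId (MGen gf)) (CGen g\<alpha>), CId (MCmp (MGen gf) (MGen g\<alpha>0)))}\<rparr>"

abbreviation example_cat2 ::
  "(gen0, (gen0, gen1) mterm set, (gen0, gen1, gen2) cterm set) cat2" where
  "example_cat2 \<equiv> generated_cat2 example_presentation"

abbreviation f_mor :: "(gen0, gen1) mterm set" where
  "f_mor \<equiv> mclass example_presentation (MGen gf)"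

lemma presentation_example: "presentation example_presentation"
proof -
  let ?P = example_presentation
  have "meq ?P (MCmp (MGen gf) (MGen g\<alpha>0)) (MCmp (MGen gf) (MGen g\<alpha>1))"
    by (rule meq_rel) (simp add: example_presentation_def)
  moreover have "mwf ?P (MCmp (MGen gf) (MGen g\<alpha>0))"
    by (simp add: example_presentation_def)
  ultimately show ?thesis
    by unfold_locales
      (auto simp: example_presentation_def intro: meq_refl meq_sym)
qed

end

theory Submission
  imports Defs
begin

text \<open>
  If every 2-morphism into the codomain of \<open>f: A \<rightarrow> B\<close> is an identity, then a lax-cone over \<open>f\<close> is
  determined by its component \<open>h: X \<rightarrow> A\<close> at \<open>0\<close> (its component at \<open>1\<close> has to be \<open>f h\<close>), and a
  modification by its component at \<open>0\<close>; hence \<open>(A, id\<^sub>f)\<close> is the lax-limit. On the other hand, any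
  non-trivial 2-morphism \<open>\<beta>: h \<Rightarrow> k\<close> into a lax-limit \<open>L\<close> yields two different morphisms from
  \<open>(X, \<lambda> k)\<close> to \<open>(L, \<lambda>)\<close> in the lax-slice, namely \<open>(h, \<lambda> * \<beta>)\<close> and \<open>(k, id)\<close>. In the example the only
  non-identity 2-morphism is \<open>\<alpha>\<close>, whose codomain is \<open>A\<close>, and \<open>\<alpha>\<^sub>0 \<noteq> \<alpha>\<^sub>1\<close>.
\<close>

section \<open>Lax-limits of a morphism whose codomain receives only identity 2-morphisms\<close>

context two_category
begin

section \<open>Hom-categories of lax-natural transformations and modifications\<close>

text \<open>The category laws hold componentwise in \<open>A\<close>; the substance is that
  modifications are closed under identities and vertical composition. An isomorphism of categories
  presupposes that both sides are categories, so \<open>lax_limit\<close> rests on this.\<close>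

lemma category_hom_cat_Lax:
  fixes I :: "('i, 'j, 'k) cat2"
  assumes "two_category I"
  shows "category (hom_cat (Lax I A) F G)"
proof -
  interpret I: two_category I by fact
  have id: "modification I A \<lparr>msrc = \<mu>, mtgt = \<mu>, mcell = (\<lambda>i\<in>Obj I. Idc A (lmor \<mu> i))\<rparr>"
    if "lax_natural I A \<mu>" for \<mu>
  proof -
    interpret lax_natural I A \<mu> by fact
    have nat: "lcell \<mu> u \<odot> (Idc A (F1 (ltgt \<mu>) u) \<star> Idc A (lmor \<mu> (Dom I u))) =
        (Idc A (lmor \<mu> (Cod I u)) \<star> Idc A (F1 (lsrc \<mu>) u)) \<odot> lcell \<mu> u"
      if u: "u \<in> Mor I" for u
      using lcell[OF u] I.Dom_Cod[OF u] F.F1[OF u] G.F1[OF u] lmor[of "Dom I u"] lmor[of "Cod I u"]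
        vcmp_Idc_left[of "lcell \<mu> u"] vcmp_Idc_right[of "lcell \<mu> u"]
      by (simp add: hcmp_Idc)
    show ?thesis
      by (intro modification.intro modification_axioms.intro)
        (use lax_natural_axioms nat in \<open>auto simp: Idc lmor I.Dom_Cod\<close>)
  qed
  have comp: "modification I A \<lparr>msrc = msrc \<phi>, mtgt = mtgt \<psi>,
      mcell = (\<lambda>i\<in>Obj I. mcell \<psi> i \<odot> mcell \<phi> i)\<rparr>"
    if "modification I A \<phi>" "modification I A \<psi>" and eq: "mtgt \<phi> = msrc \<psi>" for \<phi> \<psi>
  proof -
    interpret p: modification I A \<phi> by fact
    interpret q: modification I A \<psi> by fact
    let ?F = "lsrc (msrc \<phi>)" and ?G = "ltgt (msrc \<phi>)"
    have par: "lsrc (msrc \<psi>) = ?F" "ltgt (msrc \<psi>) = ?G" "lsrc (mtgt \<psi>) = ?F" "ltgt (mtgt \<psi>) = ?G"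
      using p.parallel q.parallel eq by auto
    have nat: "lcell (mtgt \<psi>) u \<odot> (Idc A (F1 ?G u) \<star> (mcell \<psi> (Dom I u) \<odot> mcell \<phi> (Dom I u))) =
        ((mcell \<psi> (Cod I u) \<odot> mcell \<phi> (Cod I u)) \<star> Idc A (F1 ?F u)) \<odot> lcell (msrc \<phi>) u"
      if u: "u \<in> Mor I" for u
    proof -
      let ?i = "Dom I u" and ?j = "Cod I u"
      let ?g = "Idc A (F1 ?G u)" and ?f = "Idc A (F1 ?F u)"
      have ij: "?i \<in> Obj I" "?j \<in> Obj I" using I.Dom_Cod[OF u] by auto
      note facts = p.mcell[OF ij(1)] p.mcell[OF ij(2)] q.mcell[OF ij(1)] q.mcell[OF ij(2)]
        p.\<mu>.lcell[OF u] q.\<mu>.lcell[OF u] q.\<nu>.lcell[OF u]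
        p.\<mu>.lmor[OF ij(1)] p.\<mu>.lmor[OF ij(2)] q.\<mu>.lmor[OF ij(1)] q.\<mu>.lmor[OF ij(2)]
        q.\<nu>.lmor[OF ij(1)] q.\<nu>.lmor[OF ij(2)] p.\<mu>.F.F1[OF u] p.\<mu>.G.F1[OF u]
      \<comment> \<open>Reading an identity 2-morphism as \<open>?g \<odot> ?g\<close> lets
        interchange distribute whiskering over the composite. The two naturality squares are then
        pasted, first that of \<open>\<psi>\<close>, then that of \<open>\<phi>\<close>.\<close>
      have [simp]: "?g \<odot> ?g = ?g" "?f \<odot> ?f = ?f"
        using facts by (auto simp: Idc_idem)
      note f' = facts[unfolded par eq] Idc[of "F1 ?G u"] Idc[of "F1 ?F u"]
      have "?g \<star> (mcell \<psi> ?i \<odot> mcell \<phi> ?i) = (?g \<star> mcell \<psi> ?i) \<odot> (?g \<star> mcell \<phi> ?i)"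
        using interchange[of "mcell \<phi> ?i" "mcell \<psi> ?i" ?g ?g] f' by simp
      moreover have "(mcell \<psi> ?j \<odot> mcell \<phi> ?j) \<star> ?f = (mcell \<psi> ?j \<star> ?f) \<odot> (mcell \<phi> ?j \<star> ?f)"
        using interchange[of ?f ?f "mcell \<phi> ?j" "mcell \<psi> ?j"] f' by simp
      moreover have "lcell (mtgt \<psi>) u \<odot> (?g \<star> mcell \<psi> ?i) = (mcell \<psi> ?j \<star> ?f) \<odot> lcell (msrc \<psi>) u"
        using q.mcell_natural[OF u] par by simp
      moreover have "lcell (msrc \<psi>) u \<odot> (?g \<star> mcell \<phi> ?i) = (mcell \<phi> ?j \<star> ?f) \<odot> lcell (msrc \<phi>) u"
        using p.mcell_natural[OF u] eq by simp
      moreover note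
        vcmp_assoc[of "?g \<star> mcell \<phi> ?i" "?g \<star> mcell \<psi> ?i" "lcell (mtgt \<psi>) u"]
        vcmp_assoc[of "?g \<star> mcell \<phi> ?i" "lcell (msrc \<psi>) u" "mcell \<psi> ?j \<star> ?f"]
        vcmp_assoc[of "lcell (msrc \<phi>) u" "mcell \<phi> ?j \<star> ?f" "mcell \<psi> ?j \<star> ?f"]
        hcmp[of "mcell \<phi> ?i" ?g] hcmp[of "mcell \<psi> ?i" ?g]
        hcmp[of ?f "mcell \<phi> ?j"] hcmp[of ?f "mcell \<psi> ?j"]
      ultimately show ?thesis using f' by simp
    qed
    show ?thesis
    proof (intro modification.intro modification_axioms.intro, goal_cases)
      case (7 u)
      then show ?case using nat[OF 7] I.Dom_Cod[OF 7] by simp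
    qed (use p.\<mu>.lax_natural_axioms q.\<nu>.lax_natural_axioms par p.mcell q.mcell eq in
        \<open>auto simp: vcmp\<close>)
  qed
  have mod: "lax_natural I A (msrc \<phi>)" "lax_natural I A (mtgt \<phi>)" "lsrc (mtgt \<phi>) = lsrc (msrc \<phi>)"
    "ltgt (mtgt \<phi>) = ltgt (msrc \<phi>)" "mcell \<phi> \<in> extensional (Obj I)"
    "\<And>i. i \<in> Obj I \<Longrightarrow> mcell \<phi> i \<in> Cell A \<and>
      Src A (mcell \<phi> i) = lmor (msrc \<phi>) i \<and> Tgt A (mcell \<phi> i) = lmor (mtgt \<phi>) i"
    if "modification I A \<phi>" for \<phi>
  proof -
    interpret modification I A \<phi> by fact
    show "lax_natural I A (msrc \<phi>)" "lax_natural I A (mtgt \<phi>)" "lsrc (mtgt \<phi>) = lsrc (msrc \<phi>)"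
      "ltgt (mtgt \<phi>) = ltgt (msrc \<phi>)" "mcell \<phi> \<in> extensional (Obj I)"
      by (rule \<mu>.lax_natural_axioms \<nu>.lax_natural_axioms parallel[symmetric] ext)+
    show "\<And>i. i \<in> Obj I \<Longrightarrow> mcell \<phi> i \<in> Cell A \<and>
      Src A (mcell \<phi> i) = lmor (msrc \<phi>) i \<and> Tgt A (mcell \<phi> i) = lmor (mtgt \<phi>) i"
      by (rule mcell)
  qed
  have modif_eqI: "\<phi> = \<psi>" if "msrc \<phi> = msrc \<psi>" "mtgt \<phi> = mtgt \<psi>"
    "mcell \<phi> \<in> extensional (Obj I)" "mcell \<psi> \<in> extensional (Obj I)"
    "\<And>i. i \<in> Obj I \<Longrightarrow> mcell \<phi> i = mcell \<psi> i"
    for \<phi> \<psi> :: "('i, 'j, 'k, 'o, 'm, 'c) modif"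
    using that extensionalityI[of "mcell \<phi>" "Obj I" "mcell \<psi>"] by (cases \<phi>; cases \<psi>) simp
  show ?thesis
    by unfold_locales
      (auto simp: hom_cat_def Lax_def id comp mod vcmp_assoc intro!: modif_eqI,
       (metis mod(6) vcmp_Idc_left vcmp_Idc_right)+)
qed

section \<open>The lax-limit of a morphism\<close>

text \<open>The inverse of post-composition with \<open>mor_cone A f\<close> is evaluation at
  \<open>False\<close>, the object 0 of \<open>Two\<close>. By \<open>discrete\<close>, everything
  over the object 1 can be recovered from what lies over 0.\<close>

lemma lax_limit_mor_cone:
  assumes f: "f \<in> Mor A"
    and discrete: "\<And>\<beta>. \<beta> \<in> Cell A \<Longrightarrow> Cod A (Src A \<beta>) = Cod A f \<Longrightarrow> \<beta> = Idc A (Src A \<beta>)"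
  shows "lax_limit Two A (mor_functor A f) (Dom A f) (mor_cone A f)"
proof -
  let ?F = "mor_functor A f" and ?\<pi> = "mor_cone A f" and ?L = "Lax Two A"
  note Two_simps = Two_def locally_discrete_def arrow_cat_def
  interpret F: two_functor Two A ?F by (rule two_functor_mor_functor[OF f])
  have f': "Dom A f \<in> Obj A" "Cod A f \<in> Obj A" using Dom_Cod[OF f] by auto
  \<comment> \<open>Explicit forms of the two actions of post-composition, on \<open>h\<close> and
    on \<open>\<beta>\<close>. As in \<open>mor_cone\<close>, each 2-morphism component is the
    identity on the component at the codomain, which treats the three morphisms of
    \<open>Two\<close> uniformly.\<close>
  define cone where "cone = (\<lambda>X h. \<lparr>lsrc = Delta0 Two A X, ltgt = ?F,
    lmor = (\<lambda>i\<in>Obj Two. if i then f \<cdot> h else h),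
    lcell = (\<lambda>u\<in>Mor Two. Idc A (if snd u then f \<cdot> h else h))\<rparr>)"
  define mapc where "mapc = (\<lambda>X \<beta>. \<lparr>msrc = cone X (Src A \<beta>), mtgt = cone X (Tgt A \<beta>),
    mcell = (\<lambda>i\<in>Obj Two. if i then Idc A f \<star> \<beta> else \<beta>)\<rparr>)"
  have cell_eqI: "\<beta> = \<gamma>" if "\<beta> \<in> Cell A" "\<gamma> \<in> Cell A" "Src A \<beta> = Src A \<gamma>"
    "Cod A (Src A \<gamma>) = Cod A f" for \<beta> \<gamma>
    using discrete[of \<beta>] discrete[of \<gamma>] that by metis
  have iso: "cat_isomorphism (hom_cat A X (Dom A f)) (hom_cat ?L (Delta0 Two A X) ?F)
      (\<lambda>h. ?\<pi> \<cdot>\<^bsub>?L\<^esub> Delta1 Two A h) (\<lambda>\<beta>. Idc ?L ?\<pi> \<star>\<^bsub>?L\<^esub> Delta2 Two A \<beta>)"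
    if X: "X \<in> Obj A" for X
  proof -
    let ?C = "hom_cat A X (Dom A f)" and ?D = "hom_cat ?L (Delta0 Two A X) ?F"
    let ?FO = "\<lambda>h. ?\<pi> \<cdot>\<^bsub>?L\<^esub> Delta1 Two A h" and ?FA = "\<lambda>\<beta>. Idc ?L ?\<pi> \<star>\<^bsub>?L\<^esub> Delta2 Two A \<beta>"
    interpret D: two_functor Two A "Delta0 Two A X"
      by (rule two_functor_Delta0[OF two_category_Two X])
    interpret C: category ?C by (rule category_hom_cat)
    interpret L: category ?D by (rule category_hom_cat_Lax[OF two_category_Two])
    have FO: "?FO h = cone X h" if "h \<in> Mor A" "Dom A h = X" "Cod A h = Dom A f" for h
      using that f cmp_Idm_left[of h]
      by (auto simp: cone_def Lax_def lax_cmp_def mor_cone_def Let_def Delta1_def Two_simps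
          hcmp_Idc Idc_idem Idm' f' cmp intro!: restrict_ext)
    have FA: "?FA \<beta> = mapc X \<beta>" if "\<beta> \<in> Cell A" "Dom A (Src A \<beta>) = X" "Cod A (Src A \<beta>) = Dom A f" for \<beta>
      using that Src_Tgt[of \<beta>] FO[of "Src A \<beta>"] FO[of "Tgt A \<beta>"] hcmp_Idm_left[of \<beta>]
      by (auto simp: mapc_def Lax_def Delta2_def mor_cone_def Let_def Two_simps intro!: restrict_ext)
    have cone: "lax_natural Two A (cone X h)"
      if "h \<in> Mor A" "Dom A h = X" "Cod A h = Dom A f" for h
      by (intro lax_natural.intro lax_natural_axioms.intro)
        (use f f' X that cmp_Idm_left[of h] cmp_Idm_left[of "f \<cdot> h"] cmp_Idm_right[of h]
            cmp_Idm_right[of "f \<cdot> h"] cmp[of h f] D.two_functor_axioms F.two_functor_axioms in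
          \<open>auto simp: cone_def Delta0_def mor_functor_def Let_def Two_simps
            Idm' Idc' Idm_idem Idc_idem hcmp_Idc split: if_splits\<close>)
    have mapc: "modification Two A (mapc X \<beta>)"
      if "\<beta> \<in> Cell A" "Dom A (Src A \<beta>) = X" "Cod A (Src A \<beta>) = Dom A f" for \<beta>
    proof -
      note st = Src_Tgt[OF that(1)]
      have w: "Idc A f \<star> \<beta> \<in> Cell A" "Src A (Idc A f \<star> \<beta>) = f \<cdot> Src A \<beta>"
        "Tgt A (Idc A f \<star> \<beta>) = f \<cdot> Tgt A \<beta>"
        using hcmp[of \<beta> "Idc A f"] f that by (auto simp: Idc')
      have c: "f \<cdot> Src A \<beta> \<in> Mor A" "f \<cdot> Tgt A \<beta> \<in> Mor A"
        "Dom A (f \<cdot> Src A \<beta>) = X" "Cod A (f \<cdot> Src A \<beta>) = Cod A f"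
        using cmp[of "Src A \<beta>" f] cmp[of "Tgt A \<beta>" f] f that st by auto
      show ?thesis
        by (intro modification.intro modification_axioms.intro)
          (use cone[of "Src A \<beta>"] cone[of "Tgt A \<beta>"] that st w c
            vcmp_Idc_left[of \<beta>] vcmp_Idc_right[of \<beta>] hcmp_Idm_left[of \<beta>] hcmp_Idm_right[of \<beta>]
            vcmp_Idc_left[of "Idc A f \<star> \<beta>"] vcmp_Idc_right[of "Idc A f \<star> \<beta>"]
            hcmp_Idm_left[of "Idc A f \<star> \<beta>"] hcmp_Idm_right[of "Idc A f \<star> \<beta>"] in
          \<open>auto simp: mapc_def cone_def Delta0_def mor_functor_def Let_def Two_simps
            split: if_splits\<close>)
    qed
    have F0_sel: "F0 (Delta0 Two A X) i = X" "F0 ?F i = (if i then Cod A f else Dom A f)"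
      "i \<in> Obj Two" for i
      by (simp_all add: Delta0_def mor_functor_def Let_def Two_simps)
    have cone_sel: "lsrc (cone X h) = Delta0 Two A X" "ltgt (cone X h) = ?F" for h
      by (simp_all add: cone_def)
    have mapc_sel: "msrc (mapc X \<beta>) = cone X (Src A \<beta>)" "mtgt (mapc X \<beta>) = cone X (Tgt A \<beta>)" for \<beta>
      by (simp_all add: mapc_def)
    have C_simps: "Ob ?C = {h \<in> Mor A. Dom A h = X \<and> Cod A h = Dom A f}"
      "Arr ?C = {\<beta> \<in> Cell A. Dom A (Src A \<beta>) = X \<and> Cod A (Src A \<beta>) = Dom A f}"
      "cdom ?C = Src A" "ccod ?C = Tgt A" "cide ?C = Idc A" "ccomp ?C = vcmp A"
      by (simp_all add: hom_cat_def)
    have D_simps: "Ob ?D = {\<mu>. lax_natural Two A \<mu> \<and> lsrc \<mu> = Delta0 Two A X \<and> ltgt \<mu> = ?F}"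
      "Arr ?D = {\<phi>. modification Two A \<phi> \<and> lsrc (msrc \<phi>) = Delta0 Two A X \<and> ltgt (msrc \<phi>) = ?F}"
      "cdom ?D = msrc" "ccod ?D = mtgt"
      "cide ?D = (\<lambda>\<mu>. \<lparr>msrc = \<mu>, mtgt = \<mu>, mcell = (\<lambda>i\<in>Obj Two. Idc A (lmor \<mu> i))\<rparr>)"
      "ccomp ?D = (\<lambda>\<psi> \<phi>. \<lparr>msrc = msrc \<phi>, mtgt = mtgt \<psi>,
         mcell = (\<lambda>i\<in>Obj Two. mcell \<psi> i \<odot> mcell \<phi> i)\<rparr>)"
      by (simp_all add: hom_cat_def Lax_def)
    have "cat_functor ?C ?D ?FO ?FA"
    proof (unfold_locales, goal_cases)
      case (1 h)
      then show ?case using cone[of h] FO[of h] by (auto simp: C_simps D_simps cone_def)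
    next
      case (2 \<beta>)
      then have \<beta>: "\<beta> \<in> Cell A" "Dom A (Src A \<beta>) = X" "Cod A (Src A \<beta>) = Dom A f"
        by (auto simp: C_simps)
      then have "Src A \<beta> \<in> Mor A" "Tgt A \<beta> \<in> Mor A" "Dom A (Tgt A \<beta>) = X" "Cod A (Tgt A \<beta>) = Dom A f"
        using Src_Tgt[of \<beta>] by auto
      with \<beta> show ?case using mapc[OF \<beta>] by (simp add: FA FO C_simps D_simps mapc_sel cone_sel)
    next
      case (3 h)
      then show ?case using FA[of "Idc A h"] FO[of h] f
        by (auto simp: C_simps D_simps mapc_def cone_def Idc hcmp_Idc intro!: restrict_ext)
    next
      case (4 \<beta> \<gamma>)
      then have \<beta>: "\<beta> \<in> Cell A" "Dom A (Src A \<beta>) = X" "Cod A (Src A \<beta>) = Dom A f"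
        and \<gamma>: "\<gamma> \<in> Cell A" "Dom A (Src A \<gamma>) = X" "Cod A (Src A \<gamma>) = Dom A f"
        and comp: "Tgt A \<beta> = Src A \<gamma>"
        by (auto simp: C_simps)
      have "Idc A f \<star> (\<gamma> \<odot> \<beta>) = (Idc A f \<star> \<gamma>) \<odot> (Idc A f \<star> \<beta>)"
        using interchange[of \<beta> \<gamma> "Idc A f" "Idc A f"] f \<beta> \<gamma> comp by (simp add: Idc Idc_idem)
      then have "mapc X (\<gamma> \<odot> \<beta>) = ccomp ?D (mapc X \<gamma>) (mapc X \<beta>)"
        using vcmp[OF \<beta>(1) \<gamma>(1) comp] by (auto simp: D_simps mapc_def intro!: restrict_ext)
      then show ?case
        using FA[OF \<beta>] FA[OF \<gamma>] FA[of "\<gamma> \<odot> \<beta>"] vcmp[OF \<beta>(1) \<gamma>(1) comp] \<beta>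
        by (simp add: C_simps)
    qed
    \<comment> \<open>Evaluation at 0 is functorial because composition and identities of
      modifications are componentwise.\<close>
    moreover have "cat_functor ?D ?C (\<lambda>\<mu>. lmor \<mu> False) (\<lambda>\<phi>. mcell \<phi> False)"
    proof (unfold_locales, goal_cases)
      case (1 \<mu>)
      then interpret lax_natural Two A \<mu> by (simp add: D_simps)
      show ?case using 1 lmor[of False] by (simp add: C_simps D_simps F0_sel)
    next
      case (2 \<phi>)
      then interpret modification Two A \<phi> by (simp add: D_simps)
      show ?case using 2 mcell[of False] \<mu>.lmor[of False] by (simp add: C_simps D_simps F0_sel)
    qed (simp_all add: C_simps D_simps F0_sel)
    moreover have "\<forall>h\<in>Ob ?C. lmor (?FO h) False = h" "\<forall>\<beta>\<in>Arr ?C. mcell (?FA \<beta>) False = \<beta>"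
      using FO FA by (auto simp: C_simps cone_def mapc_def Two_simps)
    moreover have FO_GO: "?FO (lmor \<mu> False) = \<mu>" if "\<mu> \<in> Ob ?D" for \<mu>
    proof -
      interpret lax_natural Two A \<mu> using that by (simp add: D_simps)
      have st: "lsrc \<mu> = Delta0 Two A X" "ltgt \<mu> = ?F" using that by (auto simp: D_simps)
      have m: "lmor \<mu> i \<in> Mor A" "Dom A (lmor \<mu> i) = X"
        "Cod A (lmor \<mu> i) = (if i then Cod A f else Dom A f)" for i
        using lmor[of i] by (auto simp: st F0_sel)
      have arrow: "(False, True) \<in> Mor Two" by (simp add: Two_simps)
      have c: "lcell \<mu> (False, True) \<in> Cell A" "Src A (lcell \<mu> (False, True)) = f \<cdot> lmor \<mu> False"
        "Tgt A (lcell \<mu> (False, True)) = lmor \<mu> True"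
        using lcell[OF arrow] m cmp_Idm_right[of "lmor \<mu> True"]
        by (auto simp: st Delta0_def mor_functor_def Let_def Two_simps)
      have "Cod A (f \<cdot> lmor \<mu> False) = Cod A f" "f \<cdot> lmor \<mu> False \<in> Mor A"
        using cmp[of "lmor \<mu> False" f] m f by auto
      \<comment> \<open>The component at \<open>(False, True)\<close> is a 2-morphism into
        \<open>Cod A f\<close>, hence an identity. Equality of its source and target then determines
        the component of \<open>\<mu>\<close> at 1.\<close>
      then have ca: "lcell \<mu> (False, True) = Idc A (f \<cdot> lmor \<mu> False)"
        and m1: "lmor \<mu> True = f \<cdot> lmor \<mu> False"
        using discrete[of "lcell \<mu> (False, True)"] c Idc[of "f \<cdot> lmor \<mu> False"] by auto
      have ci: "lcell \<mu> (i, i) = Idc A (lmor \<mu> i)" for i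
        using lcell_Idm[of i] by (simp add: Two_simps)
      have "lmor \<mu> = lmor (cone X (lmor \<mu> False))"
        using m1 by (auto simp: cone_def Two_simps fun_eq_iff)
      moreover have "lcell \<mu> u = lcell (cone X (lmor \<mu> False)) u" for u
      proof (cases "u \<in> Mor Two")
        case True
        then consider "u = (False, True)" | i where "u = (i, i)"
          by (cases u) (auto simp: Two_simps le_bool_def)
        then show ?thesis using ci ca m1 True by cases (auto simp: cone_def)
      next
        case False
        then show ?thesis using extensional_arb[OF ext(2) False] by (simp add: cone_def)
      qed
      ultimately have "\<mu> = cone X (lmor \<mu> False)"
        using st by (auto intro!: lax.equality simp: cone_def)
      then show ?thesis using FO m[of False] by simp
    qed
    moreover have "?FA (mcell \<phi> False) = \<phi>" if \<phi>: "\<phi> \<in> Arr ?D" for \<phi>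
    proof -
      interpret modification Two A \<phi> using \<phi> by (simp add: D_simps)
      have ob: "msrc \<phi> \<in> Ob ?D" "mtgt \<phi> \<in> Ob ?D" using L.dom_cod[OF \<phi>] by (simp_all add: D_simps)
      have st: "lsrc (msrc \<phi>) = Delta0 Two A X" "ltgt (msrc \<phi>) = ?F" using \<phi> by (auto simp: D_simps)
      have m: "lmor (msrc \<phi>) i \<in> Mor A" "Dom A (lmor (msrc \<phi>) i) = X"
        "Cod A (lmor (msrc \<phi>) i) = (if i then Cod A f else Dom A f)" for i
        using \<mu>.lmor[of i] by (auto simp: st F0_sel)
      have c: "mcell \<phi> i \<in> Cell A" "Src A (mcell \<phi> i) = lmor (msrc \<phi>) i"
        "Tgt A (mcell \<phi> i) = lmor (mtgt \<phi>) i" for i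
        using mcell[of i] by (auto simp: Two_simps)
      \<comment> \<open>Both ends of \<open>\<phi>\<close> are cones of the explicit form, so the
        component at 1 has source \<open>f \<cdot> lmor (msrc \<phi>) False\<close>, as does
        \<open>Idc A f \<star> mcell \<phi> False\<close>. Two 2-morphisms into
        \<open>Cod A f\<close> with a common source coincide.\<close>
      have cones: "cone X (lmor (msrc \<phi>) False) = msrc \<phi>" "cone X (lmor (mtgt \<phi>) False) = mtgt \<phi>"
        using FO_GO[OF ob(1)] FO_GO[OF ob(2)] FO[of "lmor (msrc \<phi>) False"]
          FO[of "lmor (mtgt \<phi>) False"] m[of False] c[of False] Src_Tgt[of "mcell \<phi> False"] by auto
      have "lmor (cone X (lmor (msrc \<phi>) False)) True = f \<cdot> lmor (msrc \<phi>) False"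
        by (simp add: cone_def Two_simps)
      then have "lmor (msrc \<phi>) True = f \<cdot> lmor (msrc \<phi>) False"
        by (simp add: cones)
      then have "mcell \<phi> True = Idc A f \<star> mcell \<phi> False"
        using c[of True] c[of False] m[of True] m[of False] f hcmp[of "mcell \<phi> False" "Idc A f"]
        by (intro cell_eqI) (auto simp: Idc)
      then have "\<phi> = mapc X (mcell \<phi> False)"
        using c[of False] by (auto intro!: modif.equality simp: mapc_def cones fun_eq_iff Two_simps)
      then show ?thesis using FA[of "mcell \<phi> False"] c[of False] m[of False] by simp
    qed
    ultimately show ?thesis
      unfolding cat_isomorphism_def by blast
  qed
  then show ?thesis
    using lax_cone_mor_cone[OF f] by (simp add: lax_limit_def)
qed

end

section \<open>Non-terminality of lax-limits\<close>

text \<open>The two parallel morphisms into \<open>(L, \<pi>)\<close> have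
  \<open>Src A \<beta>\<close> and \<open>Tgt A \<beta>\<close> as underlying morphisms of
  \<open>A\<close>, so distinct ends of \<open>\<beta>\<close> already tell them apart.
  Functoriality of post-composition with \<open>\<pi>\<close> makes their second components
  modifications with the right source and target.\<close>

lemma lax_limit_not_two_terminal:
  assumes A: "two_category A" and lim: "lax_limit I A F L \<pi>"
    and \<beta>: "\<beta> \<in> Cell A" "Cod A (Src A \<beta>) = L" "Src A \<beta> \<noteq> Tgt A \<beta>"
  shows "\<not> two_terminal (lax_slice I A F) (L, \<pi>)"
proof
  assume terminal: "two_terminal (lax_slice I A F) (L, \<pi>)"
  interpret A: two_category A by fact
  let ?X = "Dom A (Src A \<beta>)" and ?L = "Lax I A"
  let ?FO = "\<lambda>h. \<pi> \<cdot>\<^bsub>?L\<^esub> Delta1 I A h" and ?FA = "\<lambda>\<beta>. Idc ?L \<pi> \<star>\<^bsub>?L\<^esub> Delta2 I A \<beta>"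
  note st = A.Src_Tgt[OF \<beta>(1)]
  have X: "?X \<in> Obj A" using st A.Dom_Cod by blast
  have cone: "lax_cone I A F L \<pi>"
    and iso: "cat_functor (hom_cat A ?X L) (hom_cat ?L (Delta0 I A ?X) F) ?FO ?FA"
    using lim X unfolding lax_limit_def cat_isomorphism_def by blast+
  interpret cat_functor "hom_cat A ?X L" "hom_cat ?L (Delta0 I A ?X) F" ?FO ?FA by (rule iso)
  have cone_t: "lax_cone I A F ?X (?FO (Tgt A \<beta>))"
    using FO[of "Tgt A \<beta>"] st \<beta> X by (simp add: hom_cat_def Lax_def lax_cone_def)
  \<comment> \<open>One family covers both morphisms: \<open>\<gamma> = \<beta>\<close> gives the
    one with modification \<open>\<pi> * \<beta>\<close>, and the identity on
    \<open>Tgt A \<beta>\<close> gives the one with an identity modification.\<close>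
  define s where "s = (\<lambda>\<gamma>. \<lparr>sdom = (?X, ?FO (Tgt A \<beta>)), scod = (L, \<pi>), smor = Src A \<gamma>, smod = ?FA \<gamma>\<rparr>)"
  have s: "s \<gamma> \<in> Ob (hom_cat (lax_slice I A F) (?X, ?FO (Tgt A \<beta>)) (L, \<pi>))"
    if "\<gamma> \<in> Cell A" "Dom A (Src A \<gamma>) = ?X" "Cod A (Src A \<gamma>) = L" "Tgt A \<gamma> = Tgt A \<beta>" for \<gamma>
    using FA[of \<gamma>] that A.Src_Tgt[of \<gamma>] cone cone_t
    by (auto simp: s_def hom_cat_def lax_slice_def is_slice_mor_def Lax_def)
  have "s \<beta> = s (Idc A (Tgt A \<beta>))"
  proof -
    have "(?X, ?FO (Tgt A \<beta>)) \<in> Obj (lax_slice I A F)"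
      using cone_t by (simp add: lax_slice_def)
    \<comment> \<open>\<open>G0\<close> is the object part of the inverse functor from
      \<open>terminal_cat\<close>; every object of the hom-category is its value at
      \<open>()\<close>.\<close>
    then obtain G0 where "\<forall>a\<in>Ob (hom_cat (lax_slice I A F) (?X, ?FO (Tgt A \<beta>)) (L, \<pi>)). G0 () = a"
      using terminal unfolding two_terminal_def cat_isomorphic_def cat_isomorphism_def
      by (metis (full_types) old.unit.exhaust)
    then show ?thesis using s[of \<beta>] s[of "Idc A (Tgt A \<beta>)"] \<beta> st A.Idc[of "Tgt A \<beta>"] by metis
  qed
  then show False using \<beta> st A.Idc[of "Tgt A \<beta>"] by (simp add: s_def)
qed

section \<open>The example\<close>

interpretation E: presentation example_presentation by (rule presentation_example)

interpretation E2: two_category example_cat2 by (rule E.two_category_generated)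

abbreviation "P \<equiv> example_presentation"
text \<open>Representatives for all morphisms of the example; \<open>f \<alpha>\<^sub>1\<close> is
  represented by \<open>f \<alpha>\<^sub>0\<close>.\<close>

abbreviation "nf_mor \<equiv> range MId \<union> range MGen \<union> {MCmp (MGen gf) (MGen g\<alpha>0)}"

text \<open>
  A functor to the monoid of self-maps of \<open>bool\<close>, separating \<open>\<alpha>\<^sub>0\<close> and \<open>\<alpha>\<^sub>1\<close>; the relation
  \<open>f \<alpha>\<^sub>0 = f \<alpha>\<^sub>1\<close> holds as \<open>f\<close> goes to a constant map.
\<close>

primrec mval :: "(gen0, gen1) mterm \<Rightarrow> bool \<Rightarrow> bool" where
  "mval (MId a) = id"
| "mval (MGen m) = (\<lambda>_. m = g\<alpha>1)"
| "mval (MCmp q p) = mval q \<circ> mval p"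

lemma meq_mval: "meq P p q \<Longrightarrow> mval p = mval q"
  by (induction rule: meq.induct) (auto simp: example_presentation_def)

text \<open>Under \<open>mval\<close>, \<open>g\<alpha>0\<close> becomes the constant
  \<open>False\<close> and \<open>g\<alpha>1\<close> the constant \<open>True\<close>.\<close>

lemma not_meq_\<alpha>: "\<not> meq P (MGen g\<alpha>0) (MGen g\<alpha>1)"
  using meq_mval[of "MGen g\<alpha>0" "MGen g\<alpha>1"] by (auto simp: fun_eq_iff)

lemma example_simps [simp]:
  "gen_obj P = UNIV" "gen_mor P = UNIV" "gen_cell P = UNIV"
  "gdom P m = (case m of g\<alpha>0 \<Rightarrow> gX | g\<alpha>1 \<Rightarrow> gX | gf \<Rightarrow> gA)"
  "gcod P m = (case m of g\<alpha>0 \<Rightarrow> gA | g\<alpha>1 \<Rightarrow> gA | gf \<Rightarrow> gB)"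
  "gsrc P c = MGen g\<alpha>0" "gtgt P c = MGen g\<alpha>1"
  by (auto simp: example_presentation_def)

lemma meq_f\<alpha>: "meq P (MCmp (MGen gf) (MGen g\<alpha>1)) (MCmp (MGen gf) (MGen g\<alpha>0))"
  by (intro meq_sym[OF meq_rel]) (simp add: example_presentation_def)

lemma ceq_f\<alpha>: "ceq P (CH (CId (MGen gf)) (CGen c)) (CId (MCmp (MGen gf) (MGen g\<alpha>0)))"
  by (rule ceq_rel, cases c) (simp add: example_presentation_def)

section \<open>Normal forms of morphisms\<close>

text \<open>No generator starts at B or ends at X, so the only composable pairs of non-identity
  normal forms are \<open>gf\<close> after \<open>g\<alpha>0\<close> or
  \<open>g\<alpha>1\<close>.\<close>

lemma mor_normal_form: "mwf P p \<Longrightarrow> \<exists>n\<in>nf_mor. meq P p n"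
proof (induction p)
  case (MCmp q p)
  then obtain m n where n: "n \<in> nf_mor" "meq P q n" and m: "m \<in> nf_mor" "meq P p m" by auto
  have wf: "mwf P n" "mwf P m" "mcod P m = mdom P n"
    using E.meq_wf[OF n(2)] E.meq_wf[OF m(2)] MCmp.prems by auto
  have "\<exists>k\<in>nf_mor. meq P (MCmp n m) k"
  proof (cases "n \<in> range MId \<or> m \<in> range MId")
    case True
    then show ?thesis
      using wf meq_id_left[of P m] meq_id_right[of P n] n(1) m(1) by auto
  next
    case False
    then have "n = MGen gf \<and> (m = MGen g\<alpha>0 \<or> m = MGen g\<alpha>1)"
      using n(1) m(1) wf
      by (auto split: gen1.splits)
    then show ?thesis using meq_f\<alpha> meq_refl[of P "MCmp (MGen gf) (MGen g\<alpha>0)"] by auto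
  qed
  then show ?case
    using meq_cmp[OF m(2) n(2)] MCmp.prems by (auto intro: meq_trans)
qed (use meq_refl[of P] in \<open>fastforce+\<close>)

text \<open>This and the next lemma list the morphisms that can be whiskered onto \<alpha>: on the
  right those into X, on the left those out of A.\<close>

lemma mor_into_X: "mwf P p \<Longrightarrow> mcod P p = gX \<Longrightarrow> meq P p (MId gX)"
  using mor_normal_form[of p]
  by (auto simp: image_iff dest: E.meq_wf split: gen1.splits) (frule E.meq_wf; fastforce split: gen1.splits)+

lemma mor_from_A:
  "mwf P p \<Longrightarrow> mdom P p = gA \<Longrightarrow> meq P p (MId gA) \<or> meq P p (MGen gf)"
  using mor_normal_form[of p]
  by (auto simp: image_iff dest: E.meq_wf split: gen1.splits) (frule E.meq_wf; fastforce split: gen1.splits)+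

section \<open>Normal forms of 2-morphisms\<close>

text \<open>Identities and \<alpha> are closed under both compositions: \<alpha> is composable with
  itself neither vertically, since \<open>g\<alpha>0\<close> and \<open>g\<alpha>1\<close> differ,
  nor horizontally, since it goes from X to A. Whiskering \<alpha> with an identity changes nothing,
  and whiskering with f gives an identity by the relation.\<close>

lemma cell_normal_form:
  "cwf P x \<Longrightarrow> ceq P x (CId (csrc P x)) \<or> ceq P x (CGen g\<alpha>)"
proof (induction x)
  case (CGen c)
  then show ?case by (cases c) (simp add: ceq_refl)
next
  case (CV y x)
  then have wf: "cwf P y" "cwf P x" "meq P (ctgt P x) (csrc P y)" by auto
  consider "ceq P x (CId (csrc P x))" | "ceq P y (CId (csrc P y))"
    | "ceq P x (CGen g\<alpha>)" "ceq P y (CGen g\<alpha>)"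
    using CV.IH wf by blast
  then show ?case
  proof cases
    case 1
    \<comment> \<open>The composite reduces to \<open>y\<close>, but its formal source is that of
      \<open>x\<close>. The sources are only congruent, so an identity has to be transported along
      \<open>*\<close>.\<close>
    have "meq P (csrc P x) (ctgt P x)"
      using E.ceq_wf[OF 1] by (auto intro: meq_trans meq_sym)
    then have *: "meq P (csrc P x) (csrc P y)" using wf by (auto intro: meq_trans)
    then have "ceq P x (CId (csrc P y))" using 1 by (auto intro: ceq_trans ceq_id)
    then have "ceq P (CV y x) (CV y (CId (csrc P y)))"
      using wf by (intro ceq_v ceq_refl) auto
    then have "ceq P (CV y x) y" using ceq_v_id_right[OF wf(1)] by (rule ceq_trans)
    then show ?thesis using CV.IH(1)[OF wf(1)] ceq_id[OF meq_sym[OF *]]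
      by (auto intro: ceq_trans)
  next
    case 2
    then have "ceq P y (CId (ctgt P x))" using wf by (auto intro: ceq_trans ceq_id meq_sym)
    then have "ceq P (CV y x) (CV (CId (ctgt P x)) x)"
      using wf by (intro ceq_v ceq_refl) auto
    then have "ceq P (CV y x) x" using ceq_v_id_left[OF wf(2)] by (rule ceq_trans)
    then show ?thesis using CV.IH(2)[OF wf(2)] by (auto intro: ceq_trans)
  next
    case 3
    \<comment> \<open>A composite of \<alpha> with itself would force its target and source to
      agree.\<close>
    then have "meq P (MGen g\<alpha>1) (MGen g\<alpha>0)"
      using E.ceq_wf[OF 3(1)] E.ceq_wf[OF 3(2)] wf(3)
      by (auto intro: meq_trans meq_sym)
    then show ?thesis using not_meq_\<alpha> meq_sym by blast
  qed
next
  case (CH y x)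
  then have wf: "cwf P y" "cwf P x" "mcod P (csrc P x) = mdom P (csrc P y)" by auto
  have src: "mwf P (csrc P x)" "mwf P (csrc P y)"
    using E.csrc_ctgt wf by auto
  consider "ceq P x (CId (csrc P x))" "ceq P y (CId (csrc P y))"
    | "ceq P x (CGen g\<alpha>)" "ceq P y (CId (csrc P y))"
    | "ceq P y (CGen g\<alpha>)"
    using CH.IH wf by blast
  then show ?case
  proof cases
    case 1
    have "ceq P (CH y x) (CH (CId (csrc P y)) (CId (csrc P x)))"
      using 1 CH.prems by (rule ceq_h)
    then show ?thesis using ceq_h_id[of P "csrc P y" "csrc P x"] src wf
      by (auto intro: ceq_trans)
  next
    case 2
    have "meq P (csrc P x) (MGen g\<alpha>0)" using E.ceq_wf[OF 2(1)] by simp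
    then have "mdom P (csrc P y) = gA" using wf E.meq_wf by fastforce
    then consider "meq P (csrc P y) (MId gA)" | "meq P (csrc P y) (MGen gf)"
      using mor_from_A src by blast
    then show ?thesis
    proof cases
      case 1
      have "ceq P y (CId (MId gA))" using 2(2) ceq_id[OF 1] by (rule ceq_trans)
      with 2(1) have "ceq P (CH y x) (CH (CId (MId gA)) (CGen g\<alpha>))"
        using CH.prems by (rule ceq_h)
      then show ?thesis using ceq_h_id_left[of P "CGen g\<alpha>"] by (auto intro: ceq_trans)
    next
      case f: 2
      have "ceq P y (CId (MGen gf))" using 2(2) ceq_id[OF f] by (rule ceq_trans)
      with 2(1) have "ceq P (CH y x) (CH (CId (MGen gf)) (CGen g\<alpha>))"
        using CH.prems by (rule ceq_h)
      \<comment> \<open>The relation on 2-morphisms yields an identity on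
        \<open>f \<alpha>\<^sub>0\<close>; it is then moved to the congruent formal source of the
        composite.\<close>
      then have *: "ceq P (CH y x) (CId (MCmp (MGen gf) (MGen g\<alpha>0)))"
        using ceq_f\<alpha> by (rule ceq_trans)
      then have "meq P (csrc P (CH y x)) (MCmp (MGen gf) (MGen g\<alpha>0))"
        using E.ceq_wf by fastforce
      then show ?thesis using * by (metis ceq_id ceq_sym ceq_trans)
    qed
  next
    case 3
    have "meq P (csrc P y) (MGen g\<alpha>0)" using E.ceq_wf[OF 3] by simp
    then have cod: "mcod P (csrc P x) = gX" using wf E.meq_wf by fastforce
    then have X: "meq P (csrc P x) (MId gX)" using mor_into_X src by blast
    \<comment> \<open>The right factor ends at X while \<alpha> ends at A, so the right factor is
      the identity on the identity of X.\<close>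
    have "\<not> ceq P x (CGen g\<alpha>)" using E.ceq_wf[of x "CGen g\<alpha>"] E.meq_wf cod by fastforce
    then have "ceq P x (CId (csrc P x))" using CH.IH wf by blast
    then have "ceq P x (CId (MId gX))" using ceq_id[OF X] by (rule ceq_trans)
    then have "ceq P (CH y x) (CH (CGen g\<alpha>) (CId (MId gX)))"
      using 3 CH.prems by (rule ceq_h)
    then show ?thesis using ceq_h_id_right[of P "CGen g\<alpha>"] by (auto intro: ceq_trans)
  qed
qed (auto intro: ceq_refl)

text \<open>Since \<alpha> ends at A, only the identity alternative of the normal form remains. This
  discharges the assumption \<open>discrete\<close> of \<open>lax_limit_mor_cone\<close>.\<close>

lemma cell_into_B:
  assumes "\<beta> \<in> Cell example_cat2" "Cod example_cat2 (Src example_cat2 \<beta>) = gB"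
  shows "\<beta> = Idc example_cat2 (Src example_cat2 \<beta>)"
proof -
  obtain x where x: "cwf P x" "\<beta> = cclass P x"
    using assms(1) by (auto simp: generated_cat2_def)
  have src: "mwf P (csrc P x)" using E.csrc_ctgt[OF x(1)] by simp
  then have "mcod P (csrc P x) = gB"
    using assms(2) x by (simp add: E.Src_Tgt_cclass E.Dom_Cod_mclass)
  then have "\<not> ceq P x (CGen g\<alpha>)"
    using E.ceq_wf[of x "CGen g\<alpha>"] E.meq_wf by fastforce
  then show ?thesis
    using cell_normal_form[OF x(1)] x src by (simp add: E.Src_Tgt_cclass E.Idc_mclass E.cclass_eq)
qed
theorem mainTheorem14:
  shows "lax_limit Two example_cat2 (mor_functor example_cat2 f_mor)
           gA (mor_cone example_cat2 f_mor) \<and>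
         \<not> two_terminal (lax_slice Two example_cat2 (mor_functor example_cat2 f_mor))
           (gA, mor_cone example_cat2 f_mor)"
proof
  have f: "f_mor \<in> Mor example_cat2" "Dom example_cat2 f_mor = gA" "Cod example_cat2 f_mor = gB"
    using E.Dom_Cod_mclass[of "MGen gf"] by (auto simp: generated_cat2_def)
  show lim: "lax_limit Two example_cat2 (mor_functor example_cat2 f_mor)
      gA (mor_cone example_cat2 f_mor)"
    using E2.lax_limit_mor_cone[OF f(1)] cell_into_B f by simp
  \<comment> \<open>The generator \<alpha> ends at A and has distinct source and target by
    \<open>not_meq_\<alpha>\<close>, as the criterion for non-terminality requires.\<close>
  let ?\<alpha> = "cclass P (CGen g\<alpha>)"
  have "?\<alpha> \<in> Cell example_cat2" by (auto simp: generated_cat2_def)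
  moreover have "Src example_cat2 ?\<alpha> = mclass P (MGen g\<alpha>0)" "Tgt example_cat2 ?\<alpha> = mclass P (MGen g\<alpha>1)"
    using E.Src_Tgt_cclass[of "CGen g\<alpha>"] by auto
  ultimately show "\<not> two_terminal (lax_slice Two example_cat2 (mor_functor example_cat2 f_mor))
      (gA, mor_cone example_cat2 f_mor)"
    using lax_limit_not_two_terminal[OF E.two_category_generated lim, of ?\<alpha>] not_meq_\<alpha>
    by (simp add: E.Dom_Cod_mclass E.mclass_eq)
qed

end
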